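(* Let $F$ be a field and let $\mathbb{O}$ be the split octonion algebra over $F$. The group $\mathrm{SE}_6(F)$ is generated by the maps $M_x,M_x',M_x''$ and $L_x,L_x',L_x''$ on $\mathbb{J}$ as $x$ ranges through $\mathbb{O}$.
   Context: An octonion algebra $\mathbb{O}$ over a field $F$ is an $8$-dimensional unital (not necessarily associative) $F$-algebra with a quadratic form $N:\mathbb{O}\to F$ whose polar form $\langle x,y\rangle=N(x+y)-N(x)-N(y)$ is non-degenerate and such that $N(xy)=N(x)N(y)$. It is split if there is a non-zero $x$ with $N(x)=0$ (unique up to isomorphism over $F$). Put $T(x)=\langle x,1\rangle$, $\bar x=T(x)\cdot 1-x$. Scalars in $F$ are identified with $F\cdot 1\subset\mathbb{O}$. The Albert space $\mathbb{J}$ is the $27$-dimensional $F$-space of tuples $(a,b,c\mid A,B,C)$ with $a,b,c\in F$, $A,B,C\in\mathbb{O}$. The Dickson–Freudenthal determinant is $\Delta(a,b,c\mid A,B,C)=abc-aN(A)-bN(B)-cN(C)+T((AB)C)$. $\mathrm{SE}_6(F)$ is the group of all $F$-linear maps $\mathbb{J}\to\mathbb{J}$ preserving $\Delta$. For $x\in\mathbb{O}$ the following linear maps of $\mathbb{J}$ are elements of $\mathrm{SE}_6(F)$; each sends $(a,b,c\mid A,B,C)$ to: $M_x$: $(a,\,b+aN(x)+T(\bar xC),\,c\mid A+\bar x\bar B,\,B,\,C+ax)$; $M_x'$: $(a,\,b,\,c+bN(x)+T(\bar xA)\mid A+bx,\,B+\bar x\bar C,\,C)$; $M_x''$: $(a+cN(x)+T(\bar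 xB),\,b,\,c\mid A,\,B+cx,\,C+\bar x\bar A)$; $L_x$: $(a+bN(x)+T(Cx),\,b,\,c\mid A,\,B+\bar Ax,\,C+b\bar x)$; $L_x'$: $(a,\,b+cN(x)+T(Ax),\,c\mid A+c\bar x,\,B,\,C+\bar Bx)$; $L_x''$: $(a,\,b,\,c+aN(x)+T(Bx)\mid A+\bar Cx,\,B+a\bar x,\,C)$. *)

theory Defs
  imports "HOL-Analysis.Product_Vector" "HOL-Algebra.Generated_Groups"
begin

text \<open>
  The field is an arbitrary type of class \<open>field\<close>, of any characteristic.  An octonion algebra
  lives on a whole type \<open>'o\<close>; its multiplication is an explicit parameter, since it is not
  associative.
\<close>

locale octonion_algebra = vector_space scale
  for scale :: "'f::field \<Rightarrow> 'o::ab_group_add \<Rightarrow> 'o" (infixr \<open>*s\<close> 75) +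
  fixes mul :: "'o \<Rightarrow> 'o \<Rightarrow> 'o" (infixl \<open>\<odot>\<close> 70)
    and e :: 'o
    and N :: "'o \<Rightarrow> 'f"
  assumes dim_8: "dim (UNIV :: 'o set) = 8"
    and mul_linear_left: "\<And>y. Vector_Spaces.linear scale scale (\<lambda>x. x \<odot> y)"
    and mul_linear_right: "\<And>x. Vector_Spaces.linear scale scale (\<lambda>y. x \<odot> y)"
    and unit_left: "\<And>x. e \<odot> x = x"
    and unit_right: "\<And>x. x \<odot> e = x"
    \<comment> \<open>\<open>N\<close> is a quadratic form; the polar form is symmetric, so linearity in one argument
      gives bilinearity\<close>
    and N_scale: "\<And>a x. N (a *s x) = a\<^sup>2 * N x"
    and polar_linear: "\<And>y. Vector_Spaces.linear scale (*) (\<lambda>x. N (x + y) - N x - N y)"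
    and nondegenerate: "\<And>x. (\<And>y. N (x + y) - N x - N y = 0) \<Longrightarrow> x = 0"
    and N_mul: "\<And>x y. N (x \<odot> y) = N x * N y"

locale split_octonion_algebra = octonion_algebra +
  assumes split: "\<exists>x. x \<noteq> 0 \<and> N x = 0"

text \<open>The tuple \<open>(a, b, c, A, B, C)\<close> stands for $(a,b,c\mid A,B,C)$.\<close>

type_synonym ('f, 'o) albert = "'f \<times> 'f \<times> 'f \<times> 'o \<times> 'o \<times> 'o"

context octonion_algebra
begin

definition polar :: "'o \<Rightarrow> 'o \<Rightarrow> 'f" where
  "polar x y = N (x + y) - N x - N y"

definition T :: "'o \<Rightarrow> 'f" where
  "T x = polar x e"

definition bar :: "'o \<Rightarrow> 'o" where
  "bar x = T x *s e - x"

definition albert_scale :: "'f \<Rightarrow> ('f, 'o) albert \<Rightarrow> ('f, 'o) albert" where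
  "albert_scale k = (\<lambda>(a, b, c, A, B, C). (k * a, k * b, k * c, k *s A, k *s B, k *s C))"

definition Delta :: "('f, 'o) albert \<Rightarrow> 'f" where
  "Delta = (\<lambda>(a, b, c, A, B, C).
     a * b * c - a * N A - b * N B - c * N C + T ((A \<odot> B) \<odot> C))"

text \<open>
  Invertibility of the maps is not part of the definition; \<open>SE6_group\<close> below shows that it is
  automatic.
\<close>

definition SE6 :: "(('f, 'o) albert \<Rightarrow> ('f, 'o) albert) monoid" where
  "SE6 = \<lparr>carrier = {g. Vector_Spaces.linear albert_scale albert_scale g \<and>
                        (\<forall>v. Delta (g v) = Delta v)},
          monoid.mult = (\<circ>), one = id\<rparr>"

definition M :: "'o \<Rightarrow> ('f, 'o) albert \<Rightarrow> ('f, 'o) albert" where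
  "M x = (\<lambda>(a, b, c, A, B, C).
     (a, b + a * N x + T (bar x \<odot> C), c, A + bar x \<odot> bar B, B, C + a *s x))"

definition M' :: "'o \<Rightarrow> ('f, 'o) albert \<Rightarrow> ('f, 'o) albert" where
  "M' x = (\<lambda>(a, b, c, A, B, C).
     (a, b, c + b * N x + T (bar x \<odot> A), A + b *s x, B + bar x \<odot> bar C, C))"

definition M'' :: "'o \<Rightarrow> ('f, 'o) albert \<Rightarrow> ('f, 'o) albert" where
  "M'' x = (\<lambda>(a, b, c, A, B, C).
     (a + c * N x + T (bar x \<odot> B), b, c, A, B + c *s x, C + bar x \<odot> bar A))"

definition L :: "'o \<Rightarrow> ('f, 'o) albert \<Rightarrow> ('f, 'o) albert" where
  "L x = (\<lambda>(a, b, c, A, B, C).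
     (a + b * N x + T (C \<odot> x), b, c, A, B + bar A \<odot> x, C + b *s bar x))"

definition L' :: "'o \<Rightarrow> ('f, 'o) albert \<Rightarrow> ('f, 'o) albert" where
  "L' x = (\<lambda>(a, b, c, A, B, C).
     (a, b + c * N x + T (A \<odot> x), c, A + c *s bar x, B, C + bar B \<odot> x))"

definition L'' :: "'o \<Rightarrow> ('f, 'o) albert \<Rightarrow> ('f, 'o) albert" where
  "L'' x = (\<lambda>(a, b, c, A, B, C).
     (a, b, c + a * N x + T (B \<odot> x), A + bar C \<odot> x, B + a *s bar x, C))"

lemma mul_simps:
  "(x + y) \<odot> z = x \<odot> z + y \<odot> z" "(k *s x) \<odot> z = k *s (x \<odot> z)"
  "z \<odot> (x + y) = z \<odot> x + z \<odot> y" "z \<odot> (k *s x) = k *s (z \<odot> x)"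
  using mul_linear_left[of z] mul_linear_right[of z]
  by (auto simp: Vector_Spaces.linear_iff)

lemma mul_0 [simp]: "0 \<odot> z = 0" "z \<odot> 0 = 0"
  using mul_simps(2)[of 0 0 z] mul_simps(4)[of z 0 0] by auto

lemma N_0 [simp]: "N 0 = 0"
  using N_scale[of 0 0] by simp

lemma polar_simps:
  "polar (x + y) z = polar x z + polar y z" "polar (k *s x) z = k * polar x z"
  using polar_linear[of z] by (auto simp: Vector_Spaces.linear_iff polar_def)

lemma polar_commute: "polar x y = polar y x"
  by (simp add: polar_def add.commute)

lemma T_simps: "T (x + y) = T x + T y" "T (k *s x) = k * T x" "T 0 = 0"
  using polar_simps(2)[of 0 0 e] by (auto simp: T_def polar_simps)

lemma N_e: "N e = 1"
proof (rule ccontr)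
  assume "N e \<noteq> 1"
  moreover have "N e = N e * N e" using N_mul[of e e] by (simp add: unit_left)
  ultimately have "N e = 0" by auto
  then have N0: "N x = 0" for x using N_mul[of e x] by (simp add: unit_left)
  then have "x = 0" for x :: 'o by (intro nondegenerate) simp
  then have "UNIV = {0 :: 'o}" by auto
  then have "dim (UNIV :: 'o set) = 0"
    using basis_card_eq_dim[of "{}" UNIV] by (simp add: independent_empty)
  with dim_8 show False by simp
qed

lemma N_add: "N (x + y) = N x + N y + polar x y"
  by (simp add: polar_def)

lemma T_mul: "T (x \<odot> y) = T x * T y - polar x y"
proof -
  have 1: "N ((x + e) \<odot> (y + e)) = N (x + e) * N (y + e)" by (rule N_mul)
  have 2: "N (x \<odot> (y + e)) = N x * N (y + e)" by (rule N_mul)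
  have 3: "N ((x + e) \<odot> y) = N (x + e) * N y" by (rule N_mul)
  have 4: "(x + e) \<odot> (y + e) = x \<odot> y + x + y + e"
    by (simp add: mul_simps unit_left unit_right add_ac)
  have 5: "polar (x \<odot> y) x = N x * T y"
    using 2 N_mul[of x y] by (simp add: mul_simps unit_right N_add N_e T_def polar_commute algebra_simps)
  have 6: "polar (x \<odot> y) y = N y * T x"
    using 3 N_mul[of x y] by (simp add: mul_simps unit_left N_add N_e T_def polar_commute algebra_simps)
  have "N (x \<odot> y + x + y + e) = (N x + 1 + T x) * (N y + 1 + T y)"
    using 1 unfolding 4 by (simp add: N_add N_e T_def)
  moreover have "N (x \<odot> y + x + y + e) =
      N x * N y + N x + N x * T y + N y + N y * T x + polar x y + 1 + T (x \<odot> y) + T x + T y"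
    by (simp only: N_add N_e N_mul polar_simps T_def[symmetric] 5 6) (simp add: T_simps add_ac)
  ultimately show ?thesis by algebra
qed

lemma T_mul_nondegenerate:
  assumes "\<And>x. T (x \<odot> y) = 0"
  shows "y = 0"
proof -
  have p: "polar x y = T x * T y" for x using assms[of x] by (simp add: T_mul)
  have y: "y = T y *s e"
  proof -
    have "polar (y + (- T y) *s e) x = 0" for x
      using p[of x] by (simp only: polar_simps) (simp add: T_def polar_commute)
    then have "y + (- T y) *s e = 0" by (intro nondegenerate) (simp add: polar_def)
    then show ?thesis by (simp add: scale_minus_left)
  qed
  have "T y = 0" using assms[of e] by (simp add: unit_left)
  with y show ?thesis by simp
qed

lemma albert_finite_dimensional:
  "\<exists>Bs. finite_dimensional_vector_space albert_scale Bs"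
proof -
  obtain B where B: "independent B" "span B = UNIV" "card B = 8"
    using basis_exists[of UNIV] dim_8 by (metis span_subspace subspace_UNIV)
  have "finite B" using B(3) by (metis card.infinite zero_neq_numeral)
  interpret O: finite_dimensional_vector_space scale B
    using B \<open>finite B\<close> by unfold_locales auto
  interpret F: vector_space "(*) :: 'f \<Rightarrow> 'f \<Rightarrow> 'f"
    by unfold_locales (auto simp: algebra_simps)
  interpret F: finite_dimensional_vector_space "(*) :: 'f \<Rightarrow> 'f \<Rightarrow> 'f" "{1}"
  proof unfold_locales
    show "F.span {1} = UNIV" by (auto simp: F.span_singleton)
  qed (auto simp: F.dependent_single)
  interpret O2: finite_dimensional_vector_space_prod scale scale B B ..
  interpret O3: finite_dimensional_vector_space_prod scale O2.scale B O2.Basis_pair ..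
  interpret F1: finite_dimensional_vector_space_prod "(*)" O3.scale "{1}" O3.Basis_pair ..
  interpret F2: finite_dimensional_vector_space_prod "(*)" F1.scale "{1}" F1.Basis_pair ..
  interpret F3: finite_dimensional_vector_space_prod "(*)" F2.scale "{1}" F2.Basis_pair ..
  have "albert_scale = F3.scale"
    by (auto simp: fun_eq_iff albert_scale_def F3.scale_def F2.scale_def F1.scale_def
        O3.scale_def O2.scale_def)
  with F3.p.finite_dimensional_vector_space_axioms show ?thesis by metis
qed

lemma Delta_radical:
  assumes inv: "\<And>w. Delta (w + v) = Delta w"
  shows "v = 0"
proof -
  obtain a b c A B C where v: "v = (a, b, c, A, B, C)" by (metis prod.exhaust)
  have *: "(p + a) * (q + b) * (r + c) - (p + a) * N (X + A) - (q + b) * N (Y + B)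
       - (r + c) * N (Z + C) + T (((X + A) \<odot> (Y + B)) \<odot> (Z + C))
     = p * q * r - p * N X - q * N Y - r * N Z + T ((X \<odot> Y) \<odot> Z)" for p q r X Y Z
    using inv[of "(p, q, r, X, Y, Z)"] by (simp add: v Delta_def)
  define F where "F p q r = (p + a) * (q + b) * (r + c) - (p + a) * N A - (q + b) * N B
       - (r + c) * N C + T ((A \<odot> B) \<odot> C)" for p q r
  have F: "F p q r = p * q * r" for p q r
    using *[of p q r 0 0 0] by (simp add: F_def T_simps)
  have "a = F 0 1 1 - F 0 1 0 - F 0 0 1 + F 0 0 0"
    "b = F 1 0 1 - F 1 0 0 - F 0 0 1 + F 0 0 0"
    "c = F 1 1 0 - F 1 0 0 - F 0 1 0 + F 0 0 0"
    unfolding F_def by algebra+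
  then have abc: "a = 0" "b = 0" "c = 0" by (simp_all add: F)
  have C: "C = 0"
  proof (rule T_mul_nondegenerate)
    fix x
    have "T (((x + A) \<odot> (e + B)) \<odot> C) = 0" "T ((A \<odot> (e + B)) \<odot> C) = 0"
      "T (((x + A) \<odot> B) \<odot> C) = 0" "T ((A \<odot> B) \<odot> C) = 0"
      using *[of 0 0 0 x e 0] *[of 0 0 0 0 e 0] *[of 0 0 0 x 0 0] *[of 0 0 0 0 0 0]
      by (simp_all add: abc T_simps)
    then show "T (x \<odot> C) = 0"
      by (simp add: mul_simps T_simps unit_right add_ac)
  qed
  have pA: "N (X + A) = N X" and pB: "N (X + B) = N X" for X
  proof -
    show "N (X + A) = N X" using *[of 1 0 0 X 0 0] by (simp add: abc C T_simps)
    show "N (X + B) = N X" using *[of 0 1 0 0 X 0] by (simp add: abc C T_simps)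
  qed
  have "A = 0"
    using pA pA[of 0] by (intro nondegenerate) (simp add: add.commute)
  moreover have "B = 0"
    using pB pB[of 0] by (intro nondegenerate) (simp add: add.commute)
  ultimately show ?thesis by (simp add: v abc C zero_prod_def)
qed

theorem SE6_group: "group SE6"
proof (rule groupI)
  obtain Bs where "finite_dimensional_vector_space albert_scale Bs"
    using albert_finite_dimensional by blast
  then interpret J: finite_dimensional_vector_space albert_scale Bs .
  interpret JJ: vector_space_pair albert_scale albert_scale ..
  show "\<one>\<^bsub>SE6\<^esub> \<in> carrier SE6"
    using J.linear_id by (simp add: SE6_def id_def)
  fix g assume "g \<in> carrier SE6"
  then have lin: "Vector_Spaces.linear albert_scale albert_scale g"
    and pres: "\<And>v. Delta (g v) = Delta v" by (auto simp: SE6_def)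
  have add: "g (v + w) = g v + g w" for v w
    using lin unfolding Vector_Spaces.linear_iff by blast
  have "v = 0" if "g v = 0" for v
  proof (rule Delta_radical)
    fix w
    have "Delta (w + v) = Delta (g (w + v))" by (simp only: pres)
    also have "g (w + v) = g w" by (simp only: add that add_0_right)
    finally show "Delta (w + v) = Delta w" by (simp only: pres)
  qed
  then have inj: "inj g"
    using module_hom.inj_iff_eq_0 lin unfolding Vector_Spaces.linear_iff_module_hom by blast
  then have surj: "surj g" by (rule J.linear_inj_imp_surj[OF lin])
  obtain h where h: "Vector_Spaces.linear albert_scale albert_scale h" "h \<circ> g = id"
    using JJ.linear_injective_left_inverse[OF lin inj] by blast
  have "Delta (h v) = Delta v" for v
    using h(2) surj pres by (metis comp_apply id_apply surjD)
  with h show "\<exists>h\<in>carrier SE6. h \<otimes>\<^bsub>SE6\<^esub> g = \<one>\<^bsub>SE6\<^esub>"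
    by (auto simp: SE6_def)
qed (auto simp: SE6_def Vector_Spaces.linear_compose comp_assoc simp del: split_paired_All)

end

end

theory Submission
  imports Defs
begin

text \<open>
  Why the six families generate.  Let \<open>G\<close> be the group that they generate.  Given \<open>g\<close> preserving the
  determinant, \<open>g\<close> is multiplied by elements of \<open>G\<close> until the identity is left.

  The group \<open>G\<close> acts on the Albert space by row and column operations for ``three by three
  hermitian matrices'' over the octonions: \<open>M\<close>, \<open>L\<close> and their rotated copies add an octonion
  multiple of one row to another.
  Every non-zero vector can therefore be diagonalised (\<open>reach_diagonal\<close>).  The trilinear form
  obtained from the determinant distinguishes the unit vectors on the diagonal from the diagonal
  vectors with two non-zero entries (\<open>not_grey\<close>).  It replaces the usual notion of rank, and it depends
  only on the values of the determinant, so that the argument is uniform in the field.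
  Together these two facts let \<open>G\<close> move the images of the three diagonal unit vectors back to their
  places (\<open>move_to_frame\<close>).

  A map that fixes the three diagonal unit vectors acts on the three octonion entries by a triality
  triple: three isometries \<open>\<alpha>, \<beta>, \<gamma>\<close> with \<open>T ((\<alpha> A \<odot> \<beta> B) \<odot> \<gamma> C) = T ((A \<odot> B) \<odot> C)\<close>.  The group \<open>G\<close>
  contains two kinds of explicit triples.  Products of two Weyl elements act as a product of two
  reflections on one entry and by two octonion multiplications on each of the others
  (\<open>reflection_pair\<close>); commutators of an \<open>M\<close> with an \<open>L\<close> act by Eichler transformations (\<open>eichler\<close>).
  The first kind brings \<open>\<gamma> e\<close> and then \<open>\<alpha> e\<close> to \<open>e\<close>.  After that \<open>\<alpha> = \<beta> = \<gamma>\<close> is an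
  automorphism of the octonions (\<open>automorphism_frame\<close>).

  An automorphism moves an idempotent \<open>a\<close> of norm zero and trace one to another such element.  A
  product of four reflections is again an automorphism when the vectors satisfy one multiplicative
  relation, and such products bring the idempotent back (\<open>move_idempotent\<close>).  An automorphism fixing
  \<open>a\<close> is determined by a linear map of determinant one on the three-dimensional Peirce space
  \<open>{x. a \<odot> x = x \<and> T x = 0}\<close>.  Suitable Eichler transformations induce the transvections of this
  space, so that Gaussian elimination reduces the automorphism to the identity (\<open>stabilizer_G\<close>).
\<close>

section \<open>Identities in composition algebras\<close>

context octonion_algebra
begin

lemma mul_minus [simp]: "(- x) \<odot> y = - (x \<odot> y)" "x \<odot> (- y) = - (x \<odot> y)"
  using mul_simps(2)[of "-1" x y] mul_simps(4)[of x "-1" y] by (simp_all add: scale_minus_left)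

lemma mul_diff: "(x - y) \<odot> z = x \<odot> z - y \<odot> z" "z \<odot> (x - y) = z \<odot> x - z \<odot> y"
  using mul_simps(1)[of x "-y" z] mul_simps(3)[of z x "-y"] by simp_all

lemma polar_add_right: "polar z (x + y) = polar z x + polar z y"
  and polar_scale_right: "polar z (k *s x) = k * polar z x"
  by (simp_all add: polar_commute[of z] polar_simps)

lemma polar_0 [simp]: "polar 0 x = 0" "polar x 0 = 0"
  by (simp_all add: polar_def)

lemma polar_minus [simp]: "polar (- x) y = - polar x y" "polar x (- y) = - polar x y"
  using polar_simps(2)[of "-1" x y] polar_scale_right[of x "-1" y] by (simp_all add: scale_minus_left)

lemma polar_diff: "polar (x - y) z = polar x z - polar y z" "polar z (x - y) = polar z x - polar z y"
  using polar_simps(1)[of x "-y" z] polar_add_right[of z x "-y"] by simp_all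

lemma N_minus [simp]: "N (- x) = N x"
  using N_scale[of "-1" x] by (simp add: scale_minus_left)

lemma N_diff: "N (x - y) = N x + N y - polar x y"
  using N_add[of x "-y"] by simp

lemma polar_self: "polar x x = 2 * N x"
proof -
  have "x + x = 2 *s x" by (metis one_add_one scale_left_distrib scale_one)
  then show ?thesis by (simp add: polar_def N_scale)
qed

lemma T_minus [simp]: "T (- x) = - T x" by (simp add: T_def)

lemma T_diff: "T (x - y) = T x - T y" by (simp add: T_def polar_diff)

lemma T_0 [simp]: "T 0 = 0" by (rule T_simps)

lemma T_e: "T e = 2" by (simp add: T_def polar_self N_e)

lemma bar_linear: "bar (x + y) = bar x + bar y" "bar (k *s x) = k *s bar x"
  "bar (x - y) = bar x - bar y" "bar (- x) = - bar x"
  by (simp_all add: bar_def T_simps T_diff scale_left_distrib scale_right_diff_distrib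
      scale_left_diff_distrib scale_minus_left)

lemma bar_0 [simp]: "bar 0 = 0" by (simp add: bar_def)

lemma bar_e [simp]: "bar e = e"
proof -
  have "2 *s e = e + e" by (metis one_add_one scale_left_distrib scale_one)
  then show ?thesis by (simp add: bar_def T_e)
qed

lemma T_bar [simp]: "T (bar x) = T x"
  by (simp add: bar_def T_diff T_simps T_e)

lemma bar_bar [simp]: "bar (bar x) = x"
  by (simp add: bar_def T_diff T_simps T_e)

lemma polar_bar_bar [simp]: "polar (bar x) (bar y) = polar x y"
  by (simp add: bar_def polar_diff polar_simps polar_scale_right polar_self N_e T_def
      polar_commute[of e] algebra_simps)

lemma N_bar [simp]: "N (bar x) = N x"
  by (simp add: bar_def N_diff N_scale N_e polar_simps polar_commute[of e] T_def power2_eq_square)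

lemma nondegenerate_polar:
  assumes "\<And>y. polar x y = 0"
  shows "x = 0"
  using assms by (intro nondegenerate) (simp add: polar_def)

lemma polar_ext:
  assumes "\<And>z. polar x z = polar y z"
  shows "x = y"
  using nondegenerate_polar[of "x - y"] assms by (simp add: polar_diff)

lemma polar_mul_same: "polar (x \<odot> y) (x \<odot> z) = N x * polar y z"
  "polar (x \<odot> z) (y \<odot> z) = polar x y * N z"
  unfolding polar_def by (simp_all add: mul_simps[symmetric] N_mul algebra_simps)

text \<open>
  Linearising \<open>N (x \<odot> y) = N x * N y\<close> in both factors.  Putting \<open>e\<close> for one of the four vectors gives
  the adjoints of the multiplication operators, and these give the alternative laws below.\<close>

lemma polar_mul_exchange:
  "polar (x \<odot> y) (z \<odot> w) + polar (x \<odot> w) (z \<odot> y) = polar x z * polar y w"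
proof -
  have "polar ((x + z) \<odot> y) ((x + z) \<odot> w) = (N x + N z + polar x z) * polar y w"
    by (simp add: polar_mul_same N_add)
  then show ?thesis
    by (simp add: mul_simps polar_simps polar_add_right polar_mul_same polar_commute algebra_simps)
qed

lemma polar_mul_left: "polar (x \<odot> y) z = polar y (bar x \<odot> z)"
  using polar_mul_exchange[of x y e z]
  by (simp add: bar_def unit_left mul_diff mul_simps polar_diff polar_scale_right
      T_def polar_commute algebra_simps)

lemma polar_mul_right: "polar (x \<odot> y) z = polar x (z \<odot> bar y)"
  using polar_mul_exchange[of x y z e]
  by (simp add: bar_def unit_right mul_diff mul_simps polar_diff polar_scale_right
      T_def polar_commute algebra_simps)

text \<open>
  The norm is multiplicative, so multiplication by \<open>x\<close> is a similitude and its adjoint,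
  multiplication by \<open>bar x\<close>, inverts it up to the factor \<open>N x\<close>.\<close>

lemma alternative_left [simp]: "bar x \<odot> (x \<odot> y) = N x *s y"
  by (rule polar_ext) (simp add: polar_mul_left[of "bar x"] polar_mul_same polar_simps)

lemma alternative_right [simp]: "(y \<odot> x) \<odot> bar x = N x *s y"
  by (rule polar_ext) (simp add: polar_mul_right[of _ "bar x"] polar_mul_same polar_simps mult.commute)

lemma alternative_left_bar [simp]: "x \<odot> (bar x \<odot> y) = N x *s y"
  using alternative_left[of "bar x" y] by simp

lemma alternative_right_bar [simp]: "(y \<odot> bar x) \<odot> x = N x *s y"
  using alternative_right[of y "bar x"] by simp

lemma bar_mul_self [simp]: "bar x \<odot> x = N x *s e" "x \<odot> bar x = N x *s e"
  using alternative_left[of x e] alternative_right[of e x]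
   alternative_left_bar[of x e] alternative_right_bar[of e x] by (simp_all add: unit_left unit_right)

lemma alternative_linearized:
  "bar x \<odot> (y \<odot> z) + bar y \<odot> (x \<odot> z) = polar x y *s z"
  "(z \<odot> x) \<odot> bar y + (z \<odot> y) \<odot> bar x = polar x y *s z"
  using alternative_left[of "x + y" z] alternative_right[of z "x + y"]
  by (simp_all add: bar_linear mul_simps N_add scale_left_distrib algebra_simps del: bar_mul_self)

lemma bar_mul: "bar (x \<odot> y) = bar y \<odot> bar x"
proof (rule polar_ext)
  fix z
  have "polar (bar (x \<odot> y)) z = polar (x \<odot> y) (bar z)"
    by (metis bar_bar polar_bar_bar)
  also have "\<dots> = polar (z \<odot> x) (bar y)"
    by (metis bar_bar polar_mul_left polar_mul_right polar_commute)
  finally show "polar (bar (x \<odot> y)) z = polar (bar y \<odot> bar x) z"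
    by (metis bar_bar polar_mul_left polar_mul_right polar_commute)
qed

lemma T_mul_polar: "T (x \<odot> y) = polar x (bar y)"
  by (simp add: T_def polar_mul_right unit_left)

lemma T_mul_commute: "T (x \<odot> y) = T (y \<odot> x)"
  by (simp add: T_mul polar_commute)

lemma T_bar_bar: "T (bar x \<odot> bar y) = T (x \<odot> y)"
  by (metis T_bar T_mul_commute bar_mul)

lemma polar_bar: "polar (bar x) y = polar x (bar y)"
  using polar_bar_bar[of x "bar y"] by simp

lemma T_assoc: "T ((x \<odot> y) \<odot> z) = T (x \<odot> (y \<odot> z))"
  by (simp add: T_mul_polar polar_mul_right bar_mul)

lemma T_cyclic: "T ((x \<odot> y) \<odot> z) = T ((y \<odot> z) \<odot> x)"
  by (simp add: T_assoc T_mul_commute[of x])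

lemmas linear_simps = mul_simps mul_diff polar_simps polar_add_right polar_scale_right polar_diff
  T_simps T_diff bar_linear N_add N_diff N_scale

section \<open>The generators and the group they generate\<close>

text \<open>
  The rotation permutes the three index positions cyclically.  It preserves the determinant because
  \<open>T ((A \<odot> B) \<odot> C)\<close> is invariant under cyclic permutation, and it carries \<open>M\<close> to \<open>M'\<close> to \<open>M''\<close>
  and \<open>L\<close> to \<open>L'\<close> to \<open>L''\<close>.  With \<open>swap\<close> below, which carries \<open>M\<close> to \<open>L\<close>, it
  reduces the verification for all six families to \<open>M\<close>.\<close>

definition rot :: "('f, 'o) albert \<Rightarrow> ('f, 'o) albert" where
  "rot = (\<lambda>(a, b, c, A, B, C). (c, a, b, C, A, B))"

lemma rot_cubed [simp]: "rot (rot (rot v)) = v"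
  by (cases v) (simp add: rot_def)

lemma linear_albertI:
  assumes "\<And>a b c A B C a' b' c' A' B' C'. g (a + a', b + b', c + c', A + A', B + B', C + C')
     = g (a, b, c, A, B, C) + g (a', b', c', A', B', C')"
    and "\<And>k a b c A B C. g (k * a, k * b, k * c, k *s A, k *s B, k *s C)
     = albert_scale k (g (a, b, c, A, B, C))"
  shows "Vector_Spaces.linear albert_scale albert_scale g"
proof -
  obtain Bs where "finite_dimensional_vector_space albert_scale Bs"
    using albert_finite_dimensional by blast
  then interpret J: finite_dimensional_vector_space albert_scale Bs .
  interpret JJ: vector_space_pair albert_scale albert_scale ..
  show ?thesis
    unfolding Vector_Spaces.linear_iff
    using assms by (auto simp: albert_scale_def J.vector_space_axioms split: prod.splits)
qed

lemma SE6_I: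
  assumes "\<And>a b c A B C a' b' c' A' B' C'. g (a + a', b + b', c + c', A + A', B + B', C + C')
     = g (a, b, c, A, B, C) + g (a', b', c', A', B', C')"
    and "\<And>k a b c A B C. g (k * a, k * b, k * c, k *s A, k *s B, k *s C)
     = albert_scale k (g (a, b, c, A, B, C))"
    and "\<And>a b c A B C. Delta (g (a, b, c, A, B, C)) = Delta (a, b, c, A, B, C)"
  shows "g \<in> carrier SE6"
  using linear_albertI[of g] assms by (auto simp: SE6_def)

lemma rot_SE6: "rot \<in> carrier SE6"
proof (rule SE6_I)
  fix a b c A B C
  show "Delta (rot (a, b, c, A, B, C)) = Delta (a, b, c, A, B, C)"
    by (simp add: rot_def Delta_def T_cyclic[of C A B] algebra_simps)
qed (auto simp: rot_def albert_scale_def)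

lemma SE6_comp: "g \<in> carrier SE6 \<Longrightarrow> h \<in> carrier SE6 \<Longrightarrow> g \<circ> h \<in> carrier SE6"
  by (auto simp: SE6_def Vector_Spaces.linear_compose simp del: split_paired_All)

lemma M_SE6: "M x \<in> carrier SE6"
proof (rule SE6_I)
  fix a b c A B C
  have *: "polar A (bar x \<odot> bar B) = T ((A \<odot> B) \<odot> x)" 
    by (simp add: T_mul_polar polar_mul_right[of A B])
  have "T (((bar x \<odot> bar B) \<odot> B) \<odot> C) = N B * T (bar x \<odot> C)"
     "T (((bar x \<odot> bar B) \<odot> B) \<odot> x) = N B * (2 * N x)"
    by (simp_all add: linear_simps T_e)
  then show "Delta (M x (a, b, c, A, B, C)) = Delta (a, b, c, A, B, C)"
    by (simp add: M_def Delta_def linear_simps * N_mul)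
     (simp add: T_mul_polar[of "bar x"] polar_commute[of C x] algebra_simps power2_eq_square)
qed (auto simp: M_def albert_scale_def linear_simps algebra_simps)

definition swap :: "('f, 'o) albert \<Rightarrow> ('f, 'o) albert" where
  "swap = (\<lambda>(a, b, c, A, B, C). (b, a, c, bar B, bar A, bar C))"

lemma swap_SE6: "swap \<in> carrier SE6"
proof (rule SE6_I)
  fix a b c A B C
  have "T ((bar B \<odot> bar A) \<odot> bar C) = T (bar (C \<odot> (A \<odot> B)))" by (simp add: bar_mul)
  also have "\<dots> = T ((A \<odot> B) \<odot> C)" unfolding T_bar by (rule T_mul_commute)
  finally show "Delta (swap (a, b, c, A, B, C)) = Delta (a, b, c, A, B, C)"
    by (simp add: swap_def Delta_def algebra_simps)
qed (auto simp: swap_def albert_scale_def bar_linear)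

lemma L_eq: "L x = swap \<circ> M x \<circ> swap"
  by (auto simp: fun_eq_iff L_def M_def swap_def bar_linear bar_mul T_bar_bar T_mul_commute[of _ x])

lemma rotations:
  "M' x = rot \<circ> M x \<circ> (rot \<circ> rot)" "M'' x = rot \<circ> M' x \<circ> (rot \<circ> rot)"
  "L' x = rot \<circ> L x \<circ> (rot \<circ> rot)" "L'' x = rot \<circ> L' x \<circ> (rot \<circ> rot)"
  by (auto simp: fun_eq_iff L_def M_def L'_def M'_def L''_def M''_def rot_def)

lemma generators_SE6:
  "M x \<in> carrier SE6" "M' x \<in> carrier SE6" "M'' x \<in> carrier SE6"
  "L x \<in> carrier SE6" "L' x \<in> carrier SE6" "L'' x \<in> carrier SE6"
  by (simp_all only: rotations L_eq SE6_comp rot_SE6 swap_SE6 M_SE6)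

definition G :: "(('f, 'o) albert \<Rightarrow> ('f, 'o) albert) set" where
  "G = generate SE6 (range M \<union> range M' \<union> range M'' \<union> range L \<union> range L' \<union> range L'')"

lemma G_subgroup: "subgroup G SE6"
  unfolding G_def using generators_SE6
  by (intro group.generate_is_subgroup SE6_group) auto

lemma G_SE6: "g \<in> G \<Longrightarrow> g \<in> carrier SE6"
  using G_subgroup by (auto dest: subgroup.subset)

lemma G_comp: "g \<in> G \<Longrightarrow> h \<in> G \<Longrightarrow> g \<circ> h \<in> G"
  using subgroup.m_closed[OF G_subgroup] by (simp add: SE6_def)

lemma id_G: "id \<in> G"
  using subgroup.one_closed[OF G_subgroup] by (simp add: SE6_def)

lemma generators_G [simp]: "M x \<in> G" "M' x \<in> G" "M'' x \<in> G" "L x \<in> G" "L' x \<in> G" "L'' x \<in> G"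
  unfolding G_def by (auto intro: generate.incl)

text \<open>
  The reduction step of the whole proof: if \<open>g\<close> lands in \<open>G\<close> after composition with an element
  of \<open>G\<close>, it was there before.\<close>

lemma G_cancel:
  assumes "h \<in> G" "g \<in> carrier SE6" "h \<circ> g \<in> G"
  shows "g \<in> G"
proof -
  interpret group SE6 by (rule SE6_group)
  have "h \<otimes>\<^bsub>SE6\<^esub> g \<in> G" using assms(3) by (simp add: SE6_def)
  then have "inv\<^bsub>SE6\<^esub> h \<otimes>\<^bsub>SE6\<^esub> (h \<otimes>\<^bsub>SE6\<^esub> g) \<in> G"
    using assms(1) G_subgroup subgroup.m_closed subgroup.m_inv_closed by metis
  moreover have "h \<in> carrier SE6" using assms(1) by (rule G_SE6)
  ultimately show ?thesis using assms(2) by (simp add: m_assoc[symmetric])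
qed

lemma SE6_add: "g \<in> carrier SE6 \<Longrightarrow> g (v + w) = g v + g w"
  by (auto simp: SE6_def Vector_Spaces.linear_iff simp del: split_paired_All)

lemma SE6_scale: "g \<in> carrier SE6 \<Longrightarrow> g (albert_scale k v) = albert_scale k (g v)"
  by (auto simp: SE6_def Vector_Spaces.linear_iff simp del: split_paired_All)

lemma SE6_Delta: "g \<in> carrier SE6 \<Longrightarrow> Delta (g v) = Delta v"
  by (auto simp: SE6_def simp del: split_paired_All)

lemma SE6_0: "g \<in> carrier SE6 \<Longrightarrow> g 0 = 0"
  using SE6_add[of g 0 0] by simp

lemma SE6_inverse:
  assumes "g \<in> carrier SE6"
  obtains h where "h \<in> carrier SE6" "\<And>v. h (g v) = v" "\<And>v. g (h v) = v"
proof -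
  interpret group SE6 by (rule SE6_group)
  define h where "h = inv\<^bsub>SE6\<^esub> g"
  have "h \<otimes>\<^bsub>SE6\<^esub> g = \<one>\<^bsub>SE6\<^esub>" "g \<otimes>\<^bsub>SE6\<^esub> h = \<one>\<^bsub>SE6\<^esub>" "h \<in> carrier SE6"
    using assms by (auto simp: h_def)
  then show ?thesis by (intro that) (auto simp: SE6_def fun_eq_iff simp del: split_paired_All)
qed

section \<open>The trilinear form\<close>

text \<open>
  The full polarisation of the determinant.  It is defined by differences of values, so that
  preservation of the determinant as a function on the vectors already yields preservation of this
  form, over the field with two elements too.\<close>

definition trilinear :: "('f, 'o) albert \<Rightarrow> ('f, 'o) albert \<Rightarrow> ('f, 'o) albert \<Rightarrow> 'f" where
  "trilinear u v w = Delta (u + v + w) - Delta (u + v) - Delta (u + w) - Delta (v + w)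
     + Delta u + Delta v + Delta w"

lemma SE6_trilinear: "g \<in> carrier SE6 \<Longrightarrow> trilinear (g u) (g v) (g w) = trilinear u v w"
  by (simp add: trilinear_def SE6_add[symmetric] SE6_Delta)

lemma trilinear_explicit:
  "trilinear (a, b, c, A, B, C) (a', b', c', A', B', C') (a'', b'', c'', A'', B'', C'') =
     a * b' * c'' + a * b'' * c' + a' * b * c'' + a' * b'' * c + a'' * b * c' + a'' * b' * c
     - (a * polar A' A'' + a' * polar A A'' + a'' * polar A A')
     - (b * polar B' B'' + b' * polar B B'' + b'' * polar B B')
     - (c * polar C' C'' + c' * polar C C'' + c'' * polar C C')
     + T ((A \<odot> B') \<odot> C'') + T ((A \<odot> B'') \<odot> C') + T ((A' \<odot> B) \<odot> C'')
     + T ((A' \<odot> B'') \<odot> C) + T ((A'' \<odot> B) \<odot> C') + T ((A'' \<odot> B') \<odot> C)"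
  by (simp add: trilinear_def Delta_def linear_simps) (simp add: polar_commute algebra_simps)

section \<open>Moving the diagonal unit vectors\<close>

abbreviation E1 :: "('f, 'o) albert" where "E1 \<equiv> (1, 0, 0, 0, 0, 0)"
abbreviation E2 :: "('f, 'o) albert" where "E2 \<equiv> (0, 1, 0, 0, 0, 0)"
abbreviation E3 :: "('f, 'o) albert" where "E3 \<equiv> (0, 0, 1, 0, 0, 0)"

text \<open>
  The set \<open>S\<close> records the vectors already in their places, which later steps must not disturb.\<close>

definition reach :: "('f, 'o) albert set \<Rightarrow> ('f, 'o) albert \<Rightarrow> ('f, 'o) albert \<Rightarrow> bool" where
  "reach S v w \<longleftrightarrow> (\<exists>h\<in>G. (\<forall>s\<in>S. h s = s) \<and> h v = w)"

lemma reach_refl: "reach S v v"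
  unfolding reach_def using id_G by (intro bexI[of _ id]) auto

lemma reach_trans [trans]: "reach S u v \<Longrightarrow> reach S v w \<Longrightarrow> reach S u w"
  unfolding reach_def using G_comp by (metis comp_apply)

lemma reach_mono: "reach S v w \<Longrightarrow> R \<subseteq> S \<Longrightarrow> reach R v w"
  unfolding reach_def by blast

lemma T_mul_value:
  assumes "y \<noteq> 0"
  obtains x where "T (x \<odot> y) = k"
proof -
  obtain x where "T (x \<odot> y) \<noteq> 0" using T_mul_nondegenerate assms by blast
  then have "T (((k / T (x \<odot> y)) *s x) \<odot> y) = k" by (simp add: linear_simps)
  with that show ?thesis by blast
qed

lemma polar_value:
  assumes "y \<noteq> 0"
  obtains x where "polar x y = k"
  using T_mul_value[OF assms, of k] by (metis T_mul_polar polar_bar)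

text \<open>
  A diagonal vector with exactly two non-zero entries, here called grey, has a small radical: it
  consists of vectors \<open>(a, b, 0, 0, 0, C)\<close> only, whereas the radical of \<open>E1\<close> contains all \<open>(a, 0, 0, 0, B, C)\<close>.\<close>

lemma trilinear_diagonal_radical:
  assumes "p \<noteq> 0" "q \<noteq> 0" and D0: "\<And>w. trilinear (p, q, 0, 0, 0, 0) (a, b, c, A, B, C) w = 0"
  shows "c = 0" "A = 0" "B = 0"
proof -
  show "c = 0" using D0[of E1] assms by (simp add: trilinear_explicit linear_simps)
  show "A = 0"
    using D0[of "(0,0,0,y,0,0)" for y] assms
    by (intro nondegenerate_polar) (simp add: trilinear_explicit linear_simps)
  show "B = 0"
    using D0[of "(0,0,0,0,y,0)" for y] assms
    by (intro nondegenerate_polar) (simp add: trilinear_explicit linear_simps)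
qed

text \<open>
  Radicals are compared without counting dimensions.  For \<open>Y\<close>, \<open>Z\<close> in the radical of a diagonal
  vector \<open>(p, q, 0, 0, 0, 0)\<close>, the functional \<open>trilinear Y Z\<close> is always a multiple of the third
  diagonal coordinate.  In the radical of \<open>E1\<close>, however, two pairs of vectors give functionals that
  \<open>E2\<close> and \<open>E3\<close> show to be linearly independent.\<close>

lemma not_grey_E1:
  assumes g: "g \<in> carrier SE6" and "p \<noteq> 0" "q \<noteq> 0" "g E1 = (p, q, 0, 0, 0, 0)"
  shows False
proof -
  obtain x where x: "polar e x = 1"
    using polar_value[of e 1] N_e by (metis N_0 polar_commute zero_neq_one)
  have rad: "\<exists>a b C. g (0, 0, 0, 0, B, C') = (a, b, 0, 0, 0, C)" for B C'
  proof -
    obtain a b c A B' C where v: "g (0, 0, 0, 0, B, C') = (a, b, c, A, B', C)" by (metis prod.exhaust)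
    have "trilinear (p, q, 0, 0, 0, 0) (a, b, c, A, B', C) w = 0" for w
    proof -
      obtain h where h: "h \<in> carrier SE6" "\<And>v. g (h v) = v" using SE6_inverse[OF g] by metis
      have "trilinear (p, q, 0, 0, 0, 0) (a, b, c, A, B', C) w = trilinear (g E1) (g (0, 0, 0, 0, B, C')) (g (h w))"
        by (simp only: h assms v)
      also have "\<dots> = trilinear E1 (0, 0, 0, 0, B, C') (h w)" by (rule SE6_trilinear[OF g])
      also have "\<dots> = 0" by (cases "h w") (simp add: trilinear_explicit)
      finally show ?thesis .
    qed
    with trilinear_diagonal_radical[OF assms(2,3)] v show ?thesis by metis
  qed
  obtain a1 b1 C1 a2 b2 C2 a3 b3 C3 a4 b4 C4
    where v: "g (0, 0, 0, 0, e, 0) = (a1, b1, 0, 0, 0, C1)" "g (0, 0, 0, 0, x, 0) = (a2, b2, 0, 0, 0, C2)"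
      "g (0, 0, 0, 0, 0, e) = (a3, b3, 0, 0, 0, C3)" "g (0, 0, 0, 0, 0, x) = (a4, b4, 0, 0, 0, C4)"
    using rad by metis
  obtain p2 q2 c2 X2 Y2 Z2 where E2: "g E2 = (p2, q2, c2, X2, Y2, Z2)" by (metis prod.exhaust)
  obtain p3 q3 c3 X3 Y3 Z3 where E3: "g E3 = (p3, q3, c3, X3, Y3, Z3)" by (metis prod.exhaust)
  define k where "k = a1 * b2 + a2 * b1 - polar C1 C2"
  define k' where "k' = a3 * b4 + a4 * b3 - polar C3 C4"
  have "trilinear (g (0, 0, 0, 0, e, 0)) (g (0, 0, 0, 0, x, 0)) (g E2) = -1"
    "trilinear (g (0, 0, 0, 0, e, 0)) (g (0, 0, 0, 0, x, 0)) (g E3) = 0"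
    "trilinear (g (0, 0, 0, 0, 0, e)) (g (0, 0, 0, 0, 0, x)) (g E3) = -1"
    unfolding SE6_trilinear[OF g] by (simp_all add: trilinear_explicit x)
  then have "k * c2 = -1" "k * c3 = 0" "k' * c3 = -1"
    unfolding v E2 E3 by (simp_all add: trilinear_explicit k_def k'_def algebra_simps)
  then show False by auto
qed

text \<open>
  The three diagonal positions are interchanged by \<open>rot\<close>.  When all three entries are non-zero the
  determinant already gives the contradiction.\<close>

lemma not_grey:
  assumes g: "g \<in> carrier SE6" and v: "v \<in> {E1, E2, E3}" and gv: "g v = (p, q, r, 0, 0, 0)"
  shows "p \<noteq> 0 \<Longrightarrow> q \<noteq> 0 \<Longrightarrow> False" "p \<noteq> 0 \<Longrightarrow> r \<noteq> 0 \<Longrightarrow> False" "q \<noteq> 0 \<Longrightarrow> r \<noteq> 0 \<Longrightarrow> False"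
proof -
  obtain h where h: "h \<in> carrier SE6" "h E1 = (p, q, r, 0, 0, 0)"
  proof -
    have "(g \<circ> rot) E1 = g E2" "(g \<circ> (rot \<circ> rot)) E1 = g E3" by (simp_all add: rot_def)
    then show ?thesis using that[of g] that[of "g \<circ> rot"] that[of "g \<circ> (rot \<circ> rot)"] v g gv
      by (auto simp: SE6_comp rot_SE6 simp del: comp_apply)
  qed
  have "Delta (h E1) = Delta E1" by (rule SE6_Delta[OF h(1)])
  then have 0: "p * q * r = 0" by (simp add: h Delta_def)
  have h': "rot \<circ> h \<in> carrier SE6" "rot \<circ> rot \<circ> h \<in> carrier SE6"
    using h by (simp_all add: SE6_comp rot_SE6)
  show "p \<noteq> 0 \<Longrightarrow> q \<noteq> 0 \<Longrightarrow> False" using not_grey_E1[OF h(1), of p q] h 0 by auto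
  show "p \<noteq> 0 \<Longrightarrow> r \<noteq> 0 \<Longrightarrow> False" using not_grey_E1[OF h'(1), of r p] h 0 by (auto simp: rot_def)
  show "q \<noteq> 0 \<Longrightarrow> r \<noteq> 0 \<Longrightarrow> False" using not_grey_E1[OF h'(2), of q r] h 0 by (auto simp: rot_def)
qed

lemma reach_apply: "h \<in> G \<Longrightarrow> (\<And>s. s \<in> S \<Longrightarrow> h s = s) \<Longrightarrow> reach S v (h v)"
  unfolding reach_def by blast

lemma reach_M: "reach {} (a, b, c, A, B, C)
    (a, b + a * N x + T (bar x \<odot> C), c, A + bar x \<odot> bar B, B, C + a *s x)"
  using reach_apply[of "M x" "{}" "(a, b, c, A, B, C)"] by (simp add: M_def[THEN fun_cong])

lemma reach_L'': "reach {} (a, b, c, A, B, C)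
    (a, b, c + a * N x + T (B \<odot> x), A + bar C \<odot> x, B + a *s bar x, C)"
  using reach_apply[of "L'' x" "{}" "(a, b, c, A, B, C)"] by (simp add: L''_def[THEN fun_cong])

lemma reach_M': "reach {E1} (a, b, c, A, B, C)
    (a, b, c + b * N x + T (bar x \<odot> A), A + b *s x, B + bar x \<odot> bar C, C)"
  using reach_apply[of "M' x" "{E1}" "(a, b, c, A, B, C)"] by (simp add: M'_def[THEN fun_cong])

lemma reach_L: "reach {E1} (a, b, c, A, B, C)
    (a + b * N x + T (C \<odot> x), b, c, A, B + bar A \<odot> x, C + b *s bar x)"
  using reach_apply[of "L x" "{E1}" "(a, b, c, A, B, C)"] by (simp add: L_def[THEN fun_cong])

lemma reach_M'': "reach {E1, E2} (a, b, c, A, B, C)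
    (a + c * N x + T (bar x \<odot> B), b, c, A, B + c *s x, C + bar x \<odot> bar A)"
  using reach_apply[of "M'' x" "{E1, E2}" "(a, b, c, A, B, C)"] 
  by (force simp add: M''_def[THEN fun_cong])

lemma reach_L': "reach {E1, E2} (a, b, c, A, B, C)
    (a, b + c * N x + T (A \<odot> x), c, A + c *s bar x, B, C + bar B \<odot> x)"
  using reach_apply[of "L' x" "{E1, E2}" "(a, b, c, A, B, C)"] 
  by (force simp add: L'_def[THEN fun_cong])

lemmas reach_L'_E1 = reach_mono[OF reach_L', of "{E1}", simplified]
lemmas reach_M''_E1 = reach_mono[OF reach_M'', of "{E1}", simplified]

text \<open>
  A non-zero diagonal entry of the block \<open>(b, c, A)\<close> is used to clear \<open>A\<close>; if both vanish, \<open>M'\<close>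
  first creates one.  The second conclusion keeps \<open>B\<close> and \<open>C\<close> clear when they are so already.\<close>

lemma reach_lower:
  "\<exists>b' c' B' C'. reach {E1} (a, b, c, A, B, C) (a, b', c', 0, B', C') \<and> (B = 0 \<and> C = 0 \<longrightarrow> B' = 0 \<and> C' = 0)"
proof -
  have c: "\<exists>b' c' B' C'. reach {E1} (a, b, c, A, B, C) (a, b', c', 0, B', C') \<and> (B = 0 \<and> C = 0 \<longrightarrow> B' = 0 \<and> C' = 0)"
    if "c \<noteq> 0" for c a b :: 'f and A B C :: 'o
  proof -
    let ?C = "C + bar B \<odot> ((- 1 / c) *s bar A)"
    from reach_L'_E1[of a b c A B C "(- 1 / c) *s bar A"] that
    obtain b' where r: "reach {E1} (a, b, c, A, B, C) (a, b', c, 0, B, ?C)" by (auto simp: bar_linear)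
    show ?thesis by (rule exI[of _ b'], rule exI[of _ c], rule exI[of _ B], rule exI[of _ ?C]) (use r in simp)
  qed
  have b: "\<exists>b' c' B' C'. reach {E1} (a, b, c, A, B, C) (a, b', c', 0, B', C') \<and> (B = 0 \<and> C = 0 \<longrightarrow> B' = 0 \<and> C' = 0)"
    if "b \<noteq> 0" for c a b :: 'f and A B C :: 'o
  proof -
    let ?B = "B + bar ((- 1 / b) *s A) \<odot> bar C"
    from reach_M'[of a b c A B C "(- 1 / b) *s A"] that
    obtain c' where r: "reach {E1} (a, b, c, A, B, C) (a, b, c', 0, ?B, C)" by auto
    show ?thesis by (rule exI[of _ b], rule exI[of _ c'], rule exI[of _ ?B], rule exI[of _ C]) (use r in simp)
  qed
  have A: ?thesis if A0: "A \<noteq> 0" "b = 0" "c = 0"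
  proof -
    obtain x where "T (x \<odot> A) = 1" using T_mul_value[OF A0(1)] by blast
    then have 1: "reach {E1} (a, b, c, A, B, C) (a, 0, 1, A, B + x \<odot> bar C, C)"
      using reach_M'[of a b c A B C "bar x"] A0 by simp
    have "(1 :: 'f) \<noteq> 0" by simp
    from c[OF this] obtain b' c' B' C'
      where "reach {E1} (a, 0, 1, A, B + x \<odot> bar C, C) (a, b', c', 0, B', C')"
        "B + x \<odot> bar C = 0 \<and> C = 0 \<longrightarrow> B' = 0 \<and> C' = 0" by blast
    with reach_trans[OF 1] have "reach {E1} (a, b, c, A, B, C) (a, b', c', 0, B', C')"
      "B = 0 \<and> C = 0 \<longrightarrow> B' = 0 \<and> C' = 0" by auto
    then show ?thesis by blast
  qed
  consider "A = 0" | "b \<noteq> 0" | "c \<noteq> 0" | "A \<noteq> 0" "b = 0" "c = 0" by blast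
  then show ?thesis
  proof cases
    case 1
    show ?thesis by (rule exI[of _ b], rule exI[of _ c], rule exI[of _ B], rule exI[of _ C])
        (simp add: 1 reach_refl)
  next
    case 2
    then show ?thesis by (rule b)
  next
    case 3
    then show ?thesis by (rule c)
  next
    case 4
    then show ?thesis by (rule A)
  qed
qed

text \<open>
  Needed to create a non-zero diagonal entry.  If the expression vanished for all \<open>x\<close>, its polarisation
  would give \<open>b = 0\<close>, and then nondegeneracy would give \<open>C = 0\<close>.\<close>

lemma quadratic_value:
  assumes "b \<noteq> 0 \<or> C \<noteq> 0"
  obtains x where "a + b * N x + T (C \<odot> x) \<noteq> 0"
proof -
  have "\<exists>x. a + b * N x + T (C \<odot> x) \<noteq> 0"
  proof (rule ccontr)
    assume "\<not> ?thesis"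
    then have *: "a + b * N x + T (C \<odot> x) = 0" for x by blast
    have a: "a = 0" using *[of 0] by simp
    have "b * polar x y = 0" for x y
    proof -
      have "b * polar x y = (a + b * N (x + y) + T (C \<odot> (x + y)))
          - (a + b * N x + T (C \<odot> x)) - (a + b * N y + T (C \<odot> y))"
        by (simp add: linear_simps a algebra_simps)
      then show ?thesis by (simp only: *) simp
    qed
    moreover have "\<exists>x y. polar x y \<noteq> 0" using polar_value[of e 1] N_e by (metis N_0 zero_neq_one)
    ultimately have "b = 0" by (metis mult_eq_0_iff)
    then have "T (x \<odot> C) = 0" for x using *[of x] a by (simp add: T_mul_commute)
    then have "C = 0" using T_mul_nondegenerate by blast
    with assms \<open>b = 0\<close> show False by simp
  qed
  with that show ?thesis by blast
qed

lemma reach_nonzero: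
  assumes "v \<noteq> 0"
  shows "\<exists>a b c A B C. a \<noteq> 0 \<and> reach {} v (a, b, c, A, B, C)"
proof -
  obtain a b c A B C where v: "v = (a, b, c, A, B, C)" by (metis prod.exhaust)
  have 1: ?thesis if bC: "b \<noteq> 0 \<or> C \<noteq> 0"
  proof -
    obtain x where "a + b * N x + T (C \<odot> x) \<noteq> 0" using quadratic_value[OF bC] .
    then show ?thesis using reach_mono[OF reach_L[of a b c A B C x], of "{}"] unfolding v by blast
  qed
  have 2: "\<exists>a' b' c' A' B' C'. a' \<noteq> 0 \<and> reach {} (a, b, c, A, B, C) (a', b', c', A', B', C')"
    if bc: "c \<noteq> 0 \<or> B \<noteq> 0" for a b c A B C
  proof -
    have "c \<noteq> 0 \<or> bar B \<noteq> 0" using bc by (metis bar_0 bar_bar)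
    then obtain x where "a + c * N x + T (bar B \<odot> x) \<noteq> 0" by (rule quadratic_value)
    then have "a + c * N x + T (bar x \<odot> B) \<noteq> 0" using T_bar_bar[of "bar B" x] by (simp add: T_mul_commute)
    then show ?thesis using reach_mono[OF reach_M''[of a b c A B C x], of "{}"] by blast
  qed
  have 3: ?thesis if z: "a = 0" "b = 0" "c = 0" "B = 0" "C = 0"
  proof -
    have "A \<noteq> 0" using z assms v by (auto simp: zero_prod_def)
    then obtain x where "T (x \<odot> A) = 1" using T_mul_value by blast
    then have r: "reach {} v (0, 0, 1, A, 0, 0)"
      using reach_mono[OF reach_M'[of a b c A B C "bar x"], of "{}"] z v by simp
    have "(1 :: 'f) \<noteq> 0 \<or> (0 :: 'o) \<noteq> 0" by simp
    from 2[OF this] obtain a' b' c' A' B' C'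
      where "a' \<noteq> 0" "reach {} (0, 0, 1, A, 0, 0) (a', b', c', A', B', C')" by blast
    with reach_trans[OF r] show ?thesis by blast
  qed
  show ?thesis
  proof (cases "a = 0")
    case True
    then show ?thesis using 1 2 3 v by blast
  qed (use v reach_refl in blast)
qed

text \<open>
  A non-zero first entry clears \<open>C\<close> and then \<open>B\<close>; this leaves the block \<open>(b, c, A)\<close> to
  \<open>reach_lower\<close>.\<close>

lemma reach_diagonal:
  assumes "v \<noteq> 0"
  shows "\<exists>a b c. a \<noteq> 0 \<and> reach {} v (a, b, c, 0, 0, 0)"
proof -
  obtain a b c A B C where a: "a \<noteq> 0" and 1: "reach {} v (a, b, c, A, B, C)"
    using reach_nonzero[OF assms] by blast
  from reach_M[of a b c A B C "(- 1 / a) *s C"] a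
  obtain b' A' where 2: "reach {} (a, b, c, A, B, C) (a, b', c, A', B, 0)" by auto
  from reach_L''[of a b' c A' B 0 "(- 1 / a) *s bar B"] a
  obtain c' where 3: "reach {} (a, b', c, A', B, 0) (a, b', c', A', 0, 0)" by (auto simp: linear_simps)
  obtain b'' c'' where 4: "reach {E1} (a, b', c', A', 0, 0) (a, b'', c'', 0, 0, 0)"
    using reach_lower[of a b' c' A' 0 0] by blast
  show ?thesis
    using reach_trans[OF 1 reach_trans[OF 2 reach_trans[OF 3 reach_mono[OF 4]]]] a by blast
qed

end

context split_octonion_algebra
begin

text \<open>
  On a hyperbolic pair \<open>x, y\<close> with \<open>N x = 0\<close> the norm of \<open>y + s *s x\<close> is affine in \<open>s\<close>.\<close>

lemma N_surjective: obtains x where "N x = k"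
proof -
  obtain x where x: "x \<noteq> 0" "N x = 0" using split by blast
  obtain y where y: "polar y x = 1" using polar_value[OF x(1)] .
  have "N (y + (k - N y) *s x) = k" by (simp add: linear_simps x y)
  with that show ?thesis .
qed

text \<open>
  Rescaling goes through the second diagonal place: \<open>M x\<close> with \<open>N x = 1 / a\<close> puts a one there, and that
  one is then used to clear everything else.\<close>

lemma reach_E1:
  assumes "a \<noteq> 0"
  shows "reach {} (a, 0, 0, 0, 0, 0) E1"
proof -
  obtain x where x: "N x = 1 / a" by (rule N_surjective)
  have 1: "reach {} (a, 0, 0, 0, 0, 0) (a, 1, 0, 0, 0, a *s x)"
    using reach_M[of a 0 0 0 0 0 x] assms x by simp
  have 2: "reach {} (a, 1, 0, 0, 0, a *s x) E2"
    using reach_mono[OF reach_L[of a 1 0 0 0 "a *s x" "- a *s bar x"], of "{}"] assms x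
    by (simp add: linear_simps T_e scale_minus_left power2_eq_square)
  have 3: "reach {} E2 (1, 1, 0, 0, 0, e)"
    using reach_mono[OF reach_L[of 0 1 0 0 0 0 e], of "{}"] by (simp add: N_e)
  have 4: "reach {} (1, 1, 0, 0, 0, e) E1"
    using reach_M[of 1 1 0 0 0 e "- e"] by (simp add: N_e T_e linear_simps unit_left)
  show ?thesis using reach_trans[OF 1 reach_trans[OF 2 reach_trans[OF 3 4]]] .
qed

text \<open>
  The diagonal vector produced from \<open>g E1\<close> keeps a non-zero first entry, so that \<open>not_grey\<close> forces
  the other two entries to vanish.\<close>

lemma move_to_E1:
  assumes g: "g \<in> carrier SE6"
  shows "reach {} (g E1) E1"
proof -
  have "g E1 \<noteq> 0" using SE6_inverse[OF g] SE6_0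
    by (metis prod.inject zero_neq_one zero_prod_def)
  then obtain a b c where a: "a \<noteq> 0" and r: "reach {} (g E1) (a, b, c, 0, 0, 0)"
    using reach_diagonal by blast
  then obtain h where h: "h \<in> G" "(h \<circ> g) E1 = (a, b, c, 0, 0, 0)" unfolding reach_def by auto
  then have "h \<circ> g \<in> carrier SE6" using g by (simp add: SE6_comp G_SE6)
  from not_grey[OF this _ h(2)] a have "b = 0" "c = 0" by auto
  with r reach_E1[OF a] show ?thesis using reach_trans by blast
qed

text \<open>
  The analogue of \<open>reach_E1\<close> for the lower block; \<open>B\<close> and \<open>C\<close> are allowed to change arbitrarily.\<close>

lemma reach_E2_lower:
  assumes "b * c = 0" "b \<noteq> 0 \<or> c \<noteq> 0"
  shows "\<exists>B' C'. reach {E1} (a, b, c, 0, B, C) (a, 1, 0, 0, B', C')"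
proof -
  have c: "\<exists>B' C'. reach {E1} (a, 0, c, 0, B, C) (a, 1, 0, 0, B', C')" if c: "c \<noteq> 0" for c B C
  proof -
    obtain x where x: "N x = 1 / c" by (rule N_surjective)
    obtain C' where 1: "reach {E1} (a, 0, c, 0, B, C) (a, 1, c, c *s bar x, B, C')"
      using reach_L'_E1[of a 0 c 0 B C x] c x by auto
    obtain B' where 2: "reach {E1} (a, 1, c, c *s bar x, B, C') (a, 1, 0, 0, B', C')"
      using reach_M'[of a 1 c "c *s bar x" B C' "- c *s bar x"] c x
      by (auto simp add: linear_simps T_e scale_minus_left power2_eq_square)
    show ?thesis using reach_trans[OF 1 2] by blast
  qed
  show ?thesis
  proof (cases "b = 0")
    case True
    then show ?thesis using c assms(2) by simp
  next
    case False
    then have [simp]: "c = 0" using assms(1) by simp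
    obtain x where x: "N x = 1 / b" by (rule N_surjective)
    obtain B' where 1: "reach {E1} (a, b, 0, 0, B, C) (a, b, 1, b *s x, B', C)"
      using reach_M'[of a b 0 0 B C x] False x by auto
    obtain C' where 2: "reach {E1} (a, b, 1, b *s x, B', C) (a, 0, 1, 0, B', C')"
      using reach_L'_E1[of a b 1 "b *s x" B' C "- b *s bar x"] False x
      by (auto simp add: linear_simps T_e scale_minus_left power2_eq_square)
    show ?thesis using reach_trans[OF 1 reach_trans[OF 2]] c[of 1 B' C'] by fastforce
  qed
qed

text \<open>
  Since \<open>g\<close> fixes \<open>E1\<close>, it preserves the function \<open>Delta (E1 + v) - Delta v\<close>, which is \<open>b * c - N A\<close>: the
  block of \<open>g E2\<close> is singular, and it is non-zero by the trilinear form.  It can thus be moved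
  to the block of \<open>E2\<close>.  What remains outside the block, \<open>(a3, B2)\<close>, vanishes, since otherwise clearing
  \<open>B2\<close> with a non-zero first entry would leave a diagonal vector with two non-zero entries.\<close>

lemma move_to_E2:
  assumes g: "g \<in> carrier SE6" and g1: "g E1 = E1"
  shows "reach {E1} (g E2) E2"
proof -
  obtain a b c A B C where v: "g E2 = (a, b, c, A, B, C)" by (metis prod.exhaust)
  obtain b' c' B' C' where 1: "reach {E1} (g E2) (a, b', c', 0, B', C')"
    using reach_lower[of a b c A B C] unfolding v by blast
  then obtain h where h: "h \<in> G" "(h \<circ> g) E1 = E1" "(h \<circ> g) E2 = (a, b', c', 0, B', C')"
    unfolding reach_def using g1 by auto
  then have hg: "h \<circ> g \<in> carrier SE6" using g by (simp add: SE6_comp G_SE6)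
  have bc: "b' * c' = 0"
  proof -
    have "Delta ((h \<circ> g) (E1 + E2)) - Delta ((h \<circ> g) E2) = b' * c'"
      unfolding SE6_add[OF hg] h by (simp add: Delta_def linear_simps algebra_simps)
    then show ?thesis unfolding SE6_Delta[OF hg] by (simp add: Delta_def)
  qed
  have nz: "b' \<noteq> 0 \<or> c' \<noteq> 0"
  proof (rule ccontr)
    assume "\<not> ?thesis"
    then have "trilinear ((h \<circ> g) E1) ((h \<circ> g) E2) ((h \<circ> g) E3) = 0"
      unfolding h by (cases "(h \<circ> g) E3") (simp add: trilinear_explicit)
    then show False unfolding SE6_trilinear[OF hg] by (simp add: trilinear_explicit)
  qed
  obtain B2 C2 where 2: "reach {E1} (a, b', c', 0, B', C') (a, 1, 0, 0, B2, C2)"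
    using reach_E2_lower[OF bc nz] by blast
  obtain a3 where 3: "reach {E1} (a, 1, 0, 0, B2, C2) (a3, 1, 0, 0, B2, 0)"
    using reach_L[of a 1 0 0 B2 C2 "- bar C2"] by (auto simp: linear_simps)
  have r: "reach {E1} (g E2) (a3, 1, 0, 0, B2, 0)"
    using reach_trans[OF 1 reach_trans[OF 2 3]] .
  have *: "\<not> reach {} (g E2) (p, 1, 0, 0, 0, 0)" if "p \<noteq> 0" for p
  proof
    assume "reach {} (g E2) (p, 1, 0, 0, 0, 0)"
    then obtain h where h: "h \<in> G" "(h \<circ> g) E2 = (p, 1, 0, 0, 0, 0)" unfolding reach_def by auto
    then have "h \<circ> g \<in> carrier SE6" using g by (simp add: SE6_comp G_SE6)
    from not_grey(1)[OF this _ h(2)] that show False by simp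
  qed
  have NB: "N B2 = 0"
  proof -
    obtain h where "h \<in> G" "h (g E2) = (a3, 1, 0, 0, B2, 0)" using r unfolding reach_def by auto
    then have "Delta (a3, 1, 0, 0, B2, 0) = Delta E2" by (metis SE6_Delta G_SE6 g)
    then show ?thesis by (simp add: Delta_def)
  qed
  have "B2 = 0"
  proof (rule ccontr)
    assume "B2 \<noteq> 0"
    then obtain x where "T (x \<odot> B2) = 1 - a3" using T_mul_value by blast
    then have 4: "reach {E1} (a3, 1, 0, 0, B2, 0) (1, 1, 0, 0, B2, 0)"
      using reach_M''_E1[of a3 1 0 0 B2 0 "bar x"] by simp
    have 5: "reach {} (1, 1, 0, 0, B2, 0) (1, 1, 0, 0, 0, 0)"
      using reach_L''[of 1 1 0 0 B2 0 "- bar B2"] NB by (simp add: linear_simps)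
    show False using *[of 1] reach_trans[OF reach_mono[OF reach_trans[OF r 4]] 5] by simp
  qed
  moreover from this have "a3 = 0" using *[of a3] reach_mono[OF r, of "{}"] by auto
  ultimately show ?thesis using r by simp
qed

text \<open>
  The trilinear form shows that the third entry of \<open>g E3\<close> is one, and this one clears \<open>A\<close> and \<open>B\<close>.
  The values of the determinant on \<open>E3\<close>, \<open>E1 + E3\<close> and \<open>E2 + E3\<close> determine the rest up to a singular
  \<open>C2\<close>, which \<open>not_grey\<close> excludes.\<close>

lemma move_to_E3:
  assumes g: "g \<in> carrier SE6" and g12: "g E1 = E1" "g E2 = E2"
  shows "reach {E1, E2} (g E3) E3"
proof -
  obtain a b c A B C where v: "g E3 = (a, b, c, A, B, C)" by (metis prod.exhaust)
  have "trilinear (g E1) (g E2) (g E3) = c" unfolding g12 v by (simp add: trilinear_explicit)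
  then have c: "c = 1" unfolding SE6_trilinear[OF g] by (simp add: trilinear_explicit)
  obtain a2 C2 where 1: "reach {E1, E2} (g E3) (a2, b, 1, A, 0, C2)"
    using reach_M''[of a b c A B C "- B"] v c by (auto simp: linear_simps)
  obtain b3 where 2: "reach {E1, E2} (a2, b, 1, A, 0, C2) (a2, b3, 1, 0, 0, C2)"
    using reach_L'[of a2 b 1 A 0 C2 "- bar A"] by (auto simp: linear_simps)
  obtain h where h: "h \<in> G" "(h \<circ> g) E1 = E1" "(h \<circ> g) E2 = E2" "(h \<circ> g) E3 = (a2, b3, 1, 0, 0, C2)"
    using reach_trans[OF 1 2] g12 unfolding reach_def by auto
  then have hg: "h \<circ> g \<in> carrier SE6" using g by (simp add: SE6_comp G_SE6)
  have "Delta ((h \<circ> g) E3) = a2 * b3 - N C2" "Delta ((h \<circ> g) (E1 + E3)) = (1 + a2) * b3 - N C2"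
    "Delta ((h \<circ> g) (E2 + E3)) = a2 * (1 + b3) - N C2"
    unfolding SE6_add[OF hg] h by (simp_all add: Delta_def linear_simps algebra_simps)
  then have 0: "a2 * b3 - N C2 = 0" "(1 + a2) * b3 - N C2 = 0" "a2 * (1 + b3) - N C2 = 0"
    unfolding SE6_Delta[OF hg] by (simp_all add: Delta_def)
  then have ab: "b3 = 0" "a2 = 0" by (algebra, algebra)
  then have NC: "N C2 = 0" using 0 by simp
  have "C2 = 0"
  proof (rule ccontr)
    assume "C2 \<noteq> 0"
    then obtain x where "T (x \<odot> C2) = 1" using T_mul_value by blast
    then have 3: "reach {} (0, 0, 1, 0, 0, C2) (0, 1, 1, 0, 0, C2)"
      using reach_M[of 0 0 1 0 0 C2 "bar x"] by simp
    have 4: "reach {} (0, 1, 1, 0, 0, C2) (0, 1, 1, 0, 0, 0)"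
      using reach_mono[OF reach_L[of 0 1 1 0 0 C2 "- bar C2"], of "{}"] NC by (simp add: linear_simps)
    obtain k where k: "k \<in> G" "(k \<circ> (h \<circ> g)) E3 = (0, 1, 1, 0, 0, 0)"
      using reach_trans[OF 3 4] unfolding reach_def using h ab by auto
    then have "k \<circ> (h \<circ> g) \<in> carrier SE6" using hg by (simp add: SE6_comp G_SE6)
    from not_grey(3)[OF this _ k(2)] show False by simp
  qed
  then show ?thesis using reach_trans[OF 1 2] ab by simp
qed

lemma move_to_frame:
  assumes g: "g \<in> carrier SE6"
  obtains h where "h \<in> G" "(h \<circ> g) E1 = E1" "(h \<circ> g) E2 = E2" "(h \<circ> g) E3 = E3"
proof -
  obtain h1 where h1: "h1 \<in> G" "(h1 \<circ> g) E1 = E1"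
    using move_to_E1[OF g] unfolding reach_def by auto
  then have g1: "h1 \<circ> g \<in> carrier SE6" using g by (simp add: SE6_comp G_SE6)
  obtain h2 where h2: "h2 \<in> G" "h2 E1 = E1" "h2 ((h1 \<circ> g) E2) = E2"
    using move_to_E2[OF g1 h1(2)] unfolding reach_def by auto
  define g2 where "g2 = h2 \<circ> (h1 \<circ> g)"
  have g2: "g2 \<in> carrier SE6" "g2 E1 = E1" "g2 E2 = E2" 
    using g1 h1 h2 by (simp_all add: SE6_comp G_SE6 g2_def)
  obtain h3 where h3: "h3 \<in> G" "h3 E1 = E1" "h3 E2 = E2" "h3 (g2 E3) = E3"
    using move_to_E3[OF g2] unfolding reach_def by auto
  show ?thesis
    by (rule that[of "h3 \<circ> (h2 \<circ> h1)"]) (use h1 h2 h3 g2 in \<open>auto simp: G_comp g2_def\<close>)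
qed

end

section \<open>Triality triples\<close>

context octonion_algebra
begin

text \<open>
  The orthogonal reflection in the hyperplane perpendicular to a non-singular \<open>x\<close>, in any characteristic.\<close>

definition reflection :: "'o \<Rightarrow> 'o \<Rightarrow> 'o" where
  "reflection x C = C - (polar C x / N x) *s x"

text \<open>
  The analogue of the product of three elementary matrices that gives a monomial matrix in
  \<open>SL\<^sub>2\<close>; the middle factor is built from \<open>- bar x / N x\<close>, the negative of the inverse of \<open>x\<close>.\<close>

definition weyl :: "'o \<Rightarrow> ('f, 'o) albert \<Rightarrow> ('f, 'o) albert" where
  "weyl x = M x \<circ> L (- (1 / N x) *s bar x) \<circ> M x"

lemma weyl_G: "weyl x \<in> G"
  by (simp add: weyl_def G_comp)

lemma weyl_apply:
  assumes "N x \<noteq> 0"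
  shows "weyl x (a, b, c, A, B, C) =
    (b / N x, a * N x, c, bar (B \<odot> x), - (1 / N x) *s (bar A \<odot> bar x), reflection x C)"
proof -
  have T1: "T (bar x \<odot> C) = polar C x" "T (C \<odot> bar x) = polar C x"
    by (simp_all add: T_mul_polar polar_commute[of x])
  define y where "y = - (1 / N x) *s bar x"
  have y: "bar y = - (1 / N x) *s x" "N y = 1 / N x" "bar x \<odot> bar y = - e" "\<And>z. bar x \<odot> (bar y \<odot> z) = - z"
    "\<And>z. (z \<odot> x) \<odot> y = - z" "T (z \<odot> y) = - (T (z \<odot> bar x) / N x)" for z
    using assms by (simp_all add: y_def linear_simps scale_minus_left power2_eq_square)
  have 1: "M x (a, b, c, A, B, C) =
      (a, b + a * N x + polar C x, c, A + bar x \<odot> bar B, B, C + a *s x)"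
    by (simp add: M_def T1)
  have 2: "L y (a, b + a * N x + polar C x, c, A + bar x \<odot> bar B, B, C + a *s x)
     = (b / N x, b + a * N x + polar C x, c, A + bar x \<odot> bar B, bar A \<odot> y,
        reflection x C - (b / N x) *s x)"
    using assms
    by (simp add: L_def y T1 linear_simps bar_mul reflection_def T_e)
      (simp add: add_divide_distrib diff_divide_distrib scale_left_distrib scale_left_diff_distrib algebra_simps)
  have T2: "T (bar x \<odot> reflection x C) = - polar C x"
    using assms by (simp add: reflection_def mul_diff mul_simps T_diff T_simps T1 T_e)
  have 3: "M x (b / N x, b + a * N x + polar C x, c, A + bar x \<odot> bar B, bar A \<odot> y,
        reflection x C - (b / N x) *s x)
     = (b / N x, a * N x, c, bar x \<odot> bar B, bar A \<odot> y, reflection x C)"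
    using assms by (simp add: M_def bar_mul y(4) mul_diff mul_simps T_diff T_simps T_e T2)
  have "weyl x (a, b, c, A, B, C) = M x (L y (M x (a, b, c, A, B, C)))"
    by (simp add: weyl_def y_def)
  then show ?thesis unfolding 1 2 3 by (simp add: bar_mul y_def mul_simps)
qed

lemma reflection_minus: "reflection (- x) = reflection x"
  by (simp add: reflection_def fun_eq_iff)

text \<open>
  Weyl elements scale the diagonal by norms, so those of \<open>x\<close> and \<open>- y\<close> cancel there when the norms
  agree, and a triality triple remains.\<close>

lemma reflection_pair:
  assumes "N x = N y" "N x \<noteq> 0"
  shows "\<exists>h\<in>G. \<forall>a b c A B C. h (a, b, c, A, B, C) =
    (a, b, c, (1 / N x) *s (bar x \<odot> (y \<odot> A)), (1 / N x) *s ((B \<odot> y) \<odot> bar x),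
     reflection x (reflection y C))"
proof (rule bexI[of _ "weyl x \<circ> weyl (- y)"], intro allI)
  fix a b c A B C
  show "(weyl x \<circ> weyl (- y)) (a, b, c, A, B, C) =
    (a, b, c, (1 / N x) *s (bar x \<odot> (y \<odot> A)), (1 / N x) *s ((B \<odot> y) \<odot> bar x),
     reflection x (reflection y C))"
    using assms by (simp add: weyl_apply bar_linear bar_mul mul_simps reflection_minus scale_minus_left)
qed (simp add: G_comp weyl_G)

lemma generators_rot:
  assumes "h \<in> range M \<union> range M' \<union> range M'' \<union> range L \<union> range L' \<union> range L''"
  shows "rot \<circ> h \<circ> (rot \<circ> rot) \<in> G"
proof -
  have "rot \<circ> M'' x \<circ> (rot \<circ> rot) = M x" "rot \<circ> L'' x \<circ> (rot \<circ> rot) = L x" for x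
    by (auto simp: fun_eq_iff rotations)
  with assms show ?thesis
    by (elim UnE rangeE) (simp_all only: rotations[symmetric] generators_G)
qed

text \<open>
  Conjugation by \<open>rot\<close> permutes the generators, hence preserves \<open>G\<close>, although \<open>rot\<close> is not yet
  known to lie in \<open>G\<close>.\<close>

lemma G_rot:
  assumes "k \<in> G"
  shows "rot \<circ> k \<circ> (rot \<circ> rot) \<in> G"
  using assms[unfolded G_def]
proof induction
  case one
  then show ?case using id_G by (simp add: SE6_def comp_def id_def)
next
  case (incl h)
  then show ?case by (rule generators_rot)
next
  case (inv h)
  interpret group SE6 by (rule SE6_group)
  have h: "h \<in> G" using inv unfolding G_def by (rule generate.incl)
  define k where "k = rot \<circ> h \<circ> (rot \<circ> rot)"
  have k: "k \<in> G" using inv unfolding k_def by (rule generators_rot)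
  define i where "i = inv\<^bsub>SE6\<^esub> h"
  have i: "i \<in> carrier SE6" "h \<otimes>\<^bsub>SE6\<^esub> i = \<one>\<^bsub>SE6\<^esub>" using G_SE6[OF h] by (simp_all add: i_def)
  have "h \<circ> i = id" using i(2) by (simp add: SE6_def)
  then have ih: "h (i v) = v" for v by (rule pointfree_idE)
  have "k \<circ> (rot \<circ> i \<circ> (rot \<circ> rot)) = id" by (simp add: k_def fun_eq_iff ih del: split_paired_All)
  then show ?case unfolding i_def[symmetric]
    using G_cancel[of k "rot \<circ> i \<circ> (rot \<circ> rot)"] id_G k i(1) by (simp add: SE6_comp rot_SE6 del: comp_apply)
next
  case (eng h1 h2)
  have "rot \<circ> (h1 \<otimes>\<^bsub>SE6\<^esub> h2) \<circ> (rot \<circ> rot) = (rot \<circ> h1 \<circ> (rot \<circ> rot)) \<circ> (rot \<circ> h2 \<circ> (rot \<circ> rot))"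
    by (simp add: SE6_def fun_eq_iff del: split_paired_All)
  then show ?case using eng.IH G_comp by metis
qed

text \<open>
  Rotating \<open>reflection_pair\<close> for \<open>x = u\<close>, \<open>y = e\<close> puts right multiplication by \<open>bar u\<close> on the third
  octonion entry.\<close>

lemma right_multiplication:
  assumes "N u = 1"
  shows "\<exists>h\<in>G. h E1 = E1 \<and> h E2 = E2 \<and> h E3 = E3 \<and> h (0, 0, 0, 0, 0, u) = (0, 0, 0, 0, 0, e)"
proof -
  obtain h where h: "h \<in> G" "\<And>a b c A B C. h (a, b, c, A, B, C) =
    (a, b, c, bar u \<odot> A, B \<odot> bar u, reflection u (reflection e C))"
    using reflection_pair[of u e] assms by (auto simp: unit_left unit_right N_e)
  show ?thesis
    by (rule bexI[OF _ G_rot[OF h(1)]]) (simp add: rot_def h(2) reflection_def assms)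
qed

lemma alternative_linearized_bar:
  "x \<odot> (bar y \<odot> z) + y \<odot> (bar x \<odot> z) = polar x y *s z"
  "(z \<odot> bar x) \<odot> y + (z \<odot> bar y) \<odot> x = polar x y *s z"
  using alternative_linearized(1)[of "bar x" "bar y" z] alternative_linearized(2)[of z "bar x" "bar y"]
  by simp_all

text \<open>
  For singular, mutually orthogonal \<open>x\<close>, \<open>y\<close> the commutator of \<open>M x\<close> and \<open>L (bar y)\<close> fixes the diagonal.
  If \<open>x\<close> and \<open>y\<close> are linearly independent, it is a root element of the spin group: an Eichler
  transformation on each of the three octonion entries.\<close>

lemma eichler:
  assumes "N x = 0" "N y = 0" "polar x y = 0"
  shows "\<exists>h\<in>G. \<forall>a b c A B C. h (a, b, c, A, B, C) =
    (a, b, c, A + bar x \<odot> (y \<odot> A), B - (B \<odot> x) \<odot> bar y, C + polar C y *s x - polar C x *s y)"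
proof (rule bexI[of _ "M x \<circ> L (bar y) \<circ> M (- x) \<circ> L (- bar y)"], intro allI)
  fix a b c A B C
  have 1: "bar x \<odot> (y \<odot> (bar x \<odot> w)) = 0" for w
  proof -
    have "y \<odot> (bar x \<odot> w) = - (x \<odot> (bar y \<odot> w))"
      using alternative_linearized_bar(1)[of y x w] assms(3) by (simp add: polar_commute eq_neg_iff_add_eq_0)
    then show ?thesis by (simp add: assms)
  qed
  have 2: "((w \<odot> bar y) \<odot> x) \<odot> bar y = 0" for w
  proof -
    have "(w \<odot> bar y) \<odot> x = - ((w \<odot> bar x) \<odot> y)"
      using alternative_linearized_bar(2)[of w y x] assms(3) by (simp add: polar_commute eq_neg_iff_add_eq_0)
    then show ?thesis by (simp add: assms)
  qed
  have 3: "T (bar x \<odot> z) = polar z x" "T (z \<odot> bar y) = polar z y" for z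
    by (simp_all add: T_mul_polar polar_commute[of x])
  show "(M x \<circ> L (bar y) \<circ> M (- x) \<circ> L (- bar y)) (a, b, c, A, B, C) =
    (a, b, c, A + bar x \<odot> (y \<odot> A), B - (B \<odot> x) \<odot> bar y, C + polar C y *s x - polar C x *s y)"
    by (simp add: M_def L_def linear_simps bar_mul 1 2 3 assms polar_self polar_commute[of y x])
       (simp add: algebra_simps)
qed (simp add: G_comp)

text \<open>
  The diagonal entries are values of the trilinear form at two of the fixed vectors.  For each
  \<open>i\<close>, moreover, the condition \<open>trilinear Ei v = 0\<close> forces one octonion entry of \<open>v\<close> to vanish, and
  this condition is inherited by \<open>g v\<close>.  Two such conditions single out each octonion entry.\<close>

lemma frame_fixed:
  assumes g: "g \<in> carrier SE6" and g123: "g E1 = E1" "g E2 = E2" "g E3 = E3"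
  obtains \<alpha> \<beta> \<gamma> where "\<And>a b c A B C. g (a, b, c, A, B, C) = (a, b, c, \<alpha> A, \<beta> B, \<gamma> C)"
proof -
  obtain h where h: "h \<in> carrier SE6" "\<And>v. h (g v) = v" "\<And>v. g (h v) = v" using SE6_inverse[OF g] by metis
  have rad: "trilinear u (g v) w = 0" if "\<And>w. trilinear u v w = 0" "g u = u" for u v w
    using SE6_trilinear[OF g, of u v "h w"] that h by simp
  have abc: "fst (g v) = fst v" "fst (snd (g v)) = fst (snd v)" "fst (snd (snd (g v))) = fst (snd (snd v))" for v
    using SE6_trilinear[OF g, of E2 E3 v] SE6_trilinear[OF g, of E1 E3 v] SE6_trilinear[OF g, of E1 E2 v] unfolding g123
    by (cases v; cases "g v"; simp add: trilinear_explicit)+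
  have D1: "A = 0" if "\<And>w. trilinear E1 (a, b, c, A, B, C) w = 0" for a b c A B C
    using that[of "(0, 0, 0, y, 0, 0)" for y] by (intro nondegenerate_polar) (simp add: trilinear_explicit)
  have D2: "B = 0" if "\<And>w. trilinear E2 (a, b, c, A, B, C) w = 0" for a b c A B C
    using that[of "(0, 0, 0, 0, y, 0)" for y] by (intro nondegenerate_polar) (simp add: trilinear_explicit)
  have D3: "C = 0" if "\<And>w. trilinear E3 (a, b, c, A, B, C) w = 0" for a b c A B C
    using that[of "(0, 0, 0, 0, 0, y)" for y] by (intro nondegenerate_polar) (simp add: trilinear_explicit)
  have A: "\<exists>A'. g (0, 0, 0, A, 0, 0) = (0, 0, 0, A', 0, 0)" for A
  proof -
    obtain a b c X Y Z where v: "g (0, 0, 0, A, 0, 0) = (a, b, c, X, Y, Z)" by (metis prod.exhaust)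
    have "Y = 0" by (rule D2[of a b c X Y Z]) (unfold v[symmetric], rule rad, simp_all add: g123 trilinear_explicit split_paired_all)
    moreover have "Z = 0" by (rule D3[of a b c X Y Z]) (unfold v[symmetric], rule rad, simp_all add: g123 trilinear_explicit split_paired_all)
    ultimately show ?thesis using abc[of "(0, 0, 0, A, 0, 0)"] v by simp
  qed
  have B: "\<exists>A'. g (0, 0, 0, 0, A, 0) = (0, 0, 0, 0, A', 0)" for A
  proof -
    obtain a b c X Y Z where v: "g (0, 0, 0, 0, A, 0) = (a, b, c, X, Y, Z)" by (metis prod.exhaust)
    have "X = 0" by (rule D1[of a b c X Y Z]) (unfold v[symmetric], rule rad, simp_all add: g123 trilinear_explicit split_paired_all)
    moreover have "Z = 0" by (rule D3[of a b c X Y Z]) (unfold v[symmetric], rule rad, simp_all add: g123 trilinear_explicit split_paired_all)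
    ultimately show ?thesis using abc[of "(0, 0, 0, 0, A, 0)"] v by simp
  qed
  have C: "\<exists>A'. g (0, 0, 0, 0, 0, A) = (0, 0, 0, 0, 0, A')" for A
  proof -
    obtain a b c X Y Z where v: "g (0, 0, 0, 0, 0, A) = (a, b, c, X, Y, Z)" by (metis prod.exhaust)
    have "X = 0" by (rule D1[of a b c X Y Z]) (unfold v[symmetric], rule rad, simp_all add: g123 trilinear_explicit split_paired_all)
    moreover have "Y = 0" by (rule D2[of a b c X Y Z]) (unfold v[symmetric], rule rad, simp_all add: g123 trilinear_explicit split_paired_all)
    ultimately show ?thesis using abc[of "(0, 0, 0, 0, 0, A)"] v by simp
  qed
  obtain \<alpha> \<beta> \<gamma> where *: "\<And>A. g (0, 0, 0, A, 0, 0) = (0, 0, 0, \<alpha> A, 0, 0)"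
     "\<And>A. g (0, 0, 0, 0, A, 0) = (0, 0, 0, 0, \<beta> A, 0)" "\<And>A. g (0, 0, 0, 0, 0, A) = (0, 0, 0, 0, 0, \<gamma> A)"
    using A B C by metis
  have "g (a, b, c, A, B, C) = (a, b, c, \<alpha> A, \<beta> B, \<gamma> C)" for a b c A B C
  proof -
    have "(a, b, c, A, B, C) = albert_scale a E1 + albert_scale b E2 + albert_scale c E3
        + (0, 0, 0, A, 0, 0) + (0, 0, 0, 0, B, 0) + (0, 0, 0, 0, 0, C)"
      by (simp add: albert_scale_def)
    then have "g (a, b, c, A, B, C) = albert_scale a E1 + albert_scale b E2 + albert_scale c E3
        + (0, 0, 0, \<alpha> A, 0, 0) + (0, 0, 0, 0, \<beta> B, 0) + (0, 0, 0, 0, 0, \<gamma> C)"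
      by (simp only: SE6_add[OF g] SE6_scale[OF g] g123 *)
    then show ?thesis by (simp add: albert_scale_def)
  qed
  with that show ?thesis .
qed

definition diag :: "('o \<Rightarrow> 'o) \<Rightarrow> ('f, 'o) albert \<Rightarrow> ('f, 'o) albert" where
  "diag \<phi> = (\<lambda>(a, b, c, A, B, C). (a, b, c, \<phi> A, \<phi> B, \<phi> C))"

text \<open>
  This describes the algebra automorphisms through the determinant; \<open>automorphism_properties\<close> shows
  that such maps are multiplicative.\<close>

definition automorphism :: "('o \<Rightarrow> 'o) \<Rightarrow> bool" where
  "automorphism \<phi> \<longleftrightarrow> diag \<phi> \<in> carrier SE6 \<and> \<phi> e = e"

lemma triality_isometries:
  assumes g: "g \<in> carrier SE6" "\<And>a b c A B C. g (a, b, c, A, B, C) = (a, b, c, \<alpha> A, \<beta> B, \<gamma> C)"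
  shows "N (\<alpha> x) = N x" "N (\<beta> x) = N x" "N (\<gamma> x) = N x"
    "polar (\<alpha> x) (\<alpha> y) = polar x y" "polar (\<beta> x) (\<beta> y) = polar x y" "polar (\<gamma> x) (\<gamma> y) = polar x y"
    "\<alpha> (x + y) = \<alpha> x + \<alpha> y" "\<beta> (x + y) = \<beta> x + \<beta> y" "\<gamma> (x + y) = \<gamma> x + \<gamma> y"
    "\<alpha> (k *s x) = k *s \<alpha> x"
    "T ((\<alpha> x \<odot> \<beta> y) \<odot> \<gamma> z) = T ((x \<odot> y) \<odot> z)"
    "\<exists>z. \<alpha> z = x" "\<exists>z. \<beta> z = x" "\<exists>z. \<gamma> z = x"
proof -
  show add: "\<alpha> (x + y) = \<alpha> x + \<alpha> y" "\<beta> (x + y) = \<beta> x + \<beta> y" "\<gamma> (x + y) = \<gamma> x + \<gamma> y" for x y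
    using SE6_add[OF g(1), of "(0, 0, 0, x, x, x)" "(0, 0, 0, y, y, y)"] by (auto simp: g(2))
  show "\<alpha> (k *s x) = k *s \<alpha> x"
    using SE6_scale[OF g(1), of k "(0, 0, 0, x, x, x)"] by (auto simp: g(2) albert_scale_def)
  have 0: "\<alpha> 0 = 0" "\<beta> 0 = 0" "\<gamma> 0 = 0"
    using SE6_0[OF g(1)] by (auto simp: g(2) zero_prod_def)
  show N: "N (\<alpha> x) = N x" "N (\<beta> x) = N x" "N (\<gamma> x) = N x" for x
    using SE6_Delta[OF g(1), of "(1, 0, 0, x, 0, 0)"] SE6_Delta[OF g(1), of "(0, 1, 0, 0, x, 0)"]
      SE6_Delta[OF g(1), of "(0, 0, 1, 0, 0, x)"] by (auto simp: g(2) Delta_def 0)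
  show "polar (\<alpha> x) (\<alpha> y) = polar x y" "polar (\<beta> x) (\<beta> y) = polar x y" "polar (\<gamma> x) (\<gamma> y) = polar x y"
    by (simp_all add: polar_def N add[symmetric])
  show "T ((\<alpha> x \<odot> \<beta> y) \<odot> \<gamma> z) = T ((x \<odot> y) \<odot> z)"
    using SE6_Delta[OF g(1), of "(0, 0, 0, x, y, z)"] by (simp add: g(2) Delta_def)
  obtain h where h: "\<And>v. g (h v) = v" using SE6_inverse[OF g(1)] by metis
  have *: "\<exists>a b c A B C. g (a, b, c, A, B, C) = (0, 0, 0, x, x, x)" using h by (metis prod.exhaust)
  then show "\<exists>z. \<alpha> z = x" "\<exists>z. \<beta> z = x" "\<exists>z. \<gamma> z = x" by (auto simp: g(2))
qed

text \<open>
  Preservation of the cubic part \<open>T ((x \<odot> y) \<odot> w)\<close> is multiplicativity tested against \<open>bar w\<close>; since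
  \<open>\<phi>\<close> is onto and commutes with conjugation, this suffices.\<close>

lemma automorphism_properties:
  assumes "automorphism \<phi>"
  shows "\<phi> e = e" "\<phi> (x + y) = \<phi> x + \<phi> y" "\<phi> (k *s x) = k *s \<phi> x" "N (\<phi> x) = N x"
    "polar (\<phi> x) (\<phi> y) = polar x y" "T (\<phi> x) = T x" "\<phi> (bar x) = bar (\<phi> x)"
    "\<phi> (x \<odot> y) = \<phi> x \<odot> \<phi> y"
proof -
  have g: "diag \<phi> \<in> carrier SE6" "\<And>a b c A B C. diag \<phi> (a, b, c, A, B, C) = (a, b, c, \<phi> A, \<phi> B, \<phi> C)"
    using assms by (auto simp: automorphism_def diag_def)
  note t = triality_isometries[OF g]
  show e: "\<phi> e = e" using assms by (simp add: automorphism_def)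
  show add: "\<phi> (x + y) = \<phi> x + \<phi> y" and scale: "\<phi> (k *s x) = k *s \<phi> x" and "N (\<phi> x) = N x"
    and polar: "polar (\<phi> x) (\<phi> y) = polar x y" for x y k by (rule t)+
  show T: "T (\<phi> x) = T x" for x unfolding T_def using polar[of x e] by (simp add: e)
  show bar: "\<phi> (bar x) = bar (\<phi> x)" for x
  proof -
    have "\<phi> (- x) = - \<phi> x" using scale[of "-1" x] by (simp add: scale_minus_left)
    then show ?thesis using add[of "T x *s e" "- x"] by (simp add: bar_def scale e T)
  qed
  show "\<phi> (x \<odot> y) = \<phi> x \<odot> \<phi> y"
  proof (rule polar_ext)
    fix z
    obtain w where w: "\<phi> (bar w) = z" using t(12) by (metis bar_bar)
    have "polar (\<phi> (x \<odot> y)) z = T ((x \<odot> y) \<odot> w)" unfolding w[symmetric] polar T_mul_polar ..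
    also have "\<dots> = T ((\<phi> x \<odot> \<phi> y) \<odot> \<phi> w)" by (rule t(11)[symmetric])
    also have "\<dots> = polar (\<phi> x \<odot> \<phi> y) z" unfolding w[symmetric] T_mul_polar bar ..
    finally show "polar (\<phi> (x \<odot> y)) z = polar (\<phi> x \<odot> \<phi> y) z" .
  qed
qed

text \<open>
  Triality with \<open>A = e\<close>, and again with \<open>C = e\<close>, expresses \<open>\<beta>\<close> as the conjugate of \<open>\<gamma>\<close> and of
  \<open>\<alpha>\<close>; both commute with conjugation because they are isometries fixing \<open>e\<close>.\<close>

lemma automorphism_frame:
  assumes g: "g \<in> carrier SE6" "g E1 = E1" "g E2 = E2" "g E3 = E3"
    "g (0, 0, 0, e, 0, 0) = (0, 0, 0, e, 0, 0)" "g (0, 0, 0, 0, 0, e) = (0, 0, 0, 0, 0, e)"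
  obtains \<phi> where "automorphism \<phi>" "g = diag \<phi>"
proof -
  obtain \<alpha> \<beta> \<gamma> where gv: "\<And>a b c A B C. g (a, b, c, A, B, C) = (a, b, c, \<alpha> A, \<beta> B, \<gamma> C)"
    using frame_fixed[OF g(1-4)] by blast
  note t = triality_isometries[OF g(1) gv]
  have e: "\<alpha> e = e" "\<gamma> e = e" using g(5,6) gv by auto
  have 1: "\<beta> (bar x) = bar (\<gamma> x)" for x
  proof (rule polar_ext)
    fix z
    obtain w where w: "\<beta> w = z" using t(13) by blast
    have "polar (\<beta> (bar x)) z = T (w \<odot> x)" using t(5)[of w "bar x"]
      by (simp add: T_mul_polar w[symmetric] polar_commute)
    also have "\<dots> = T (\<beta> w \<odot> \<gamma> x)" using t(11)[of e w x] by (simp add: e unit_left)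
    also have "\<dots> = polar (bar (\<gamma> x)) z" by (simp add: T_mul_polar w polar_commute)
    finally show "polar (\<beta> (bar x)) z = polar (bar (\<gamma> x)) z" .
  qed
  have 2: "\<beta> (bar x) = bar (\<alpha> x)" for x
  proof (rule polar_ext)
    fix z
    obtain w where w: "\<beta> w = z" using t(13) by blast
    have "polar (\<beta> (bar x)) z = T (x \<odot> w)" using t(5)[of "bar x" w]
      by (simp add: T_mul_polar w[symmetric] polar_bar)
    also have "\<dots> = T (\<alpha> x \<odot> \<beta> w)" using t(11)[of x w e] by (simp add: e unit_right)
    also have "\<dots> = polar (bar (\<alpha> x)) z" by (simp add: T_mul_polar w polar_bar)
    finally show "polar (\<beta> (bar x)) z = polar (bar (\<alpha> x)) z" .
  qed
  have 3: "\<gamma> = \<alpha>" using 1 2 by (metis bar_bar ext)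
  have "\<alpha> (bar x) = bar (\<alpha> x)" for x
  proof -
    have "T (\<alpha> x) = T x" unfolding T_def using t(4)[of x e] by (simp add: e)
    moreover have "\<alpha> (- x) = - \<alpha> x" using t(10)[of "-1" x] by (simp add: scale_minus_left)
    ultimately show ?thesis using t(7)[of "T x *s e" "- x"] t(10) by (simp add: bar_def e)
  qed
  then have "\<beta> = \<alpha>" using 2 by (metis bar_bar ext)
  then have "g = diag \<alpha>" by (auto simp: fun_eq_iff diag_def gv 3)
  with that[of \<alpha>] e g(1) show ?thesis by (simp add: automorphism_def)
qed

end

section \<open>Orthogonality and dimension\<close>

context octonion_algebra
begin

lemma finite_dimensional: "\<exists>Bs. finite_dimensional_vector_space scale Bs"
proof -
  obtain B where B: "independent B" "span B = UNIV" "card B = 8"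
    using basis_exists[of UNIV] dim_8 by (metis span_subspace subspace_UNIV)
  have "finite B" using B(3) by (metis card.infinite zero_neq_numeral)
  then have "finite_dimensional_vector_space scale B"
    using B by unfold_locales auto
  then show ?thesis ..
qed

lemma subspace_orthogonal: "subspace {z. \<forall>u\<in>X. polar z u = 0}"
  by (rule subspaceI) (auto simp: linear_simps)

lemma span_orthogonal:
  assumes "x \<in> span X" "\<And>u. u \<in> X \<Longrightarrow> polar z u = 0"
  shows "polar z x = 0"
proof -
  have "span X \<subseteq> {u. \<forall>z'\<in>{z}. polar u z' = 0}"
    by (rule span_minimal[OF _ subspace_orthogonal]) (use assms(2) in \<open>auto simp: polar_commute\<close>)
  with assms(1) show ?thesis by (auto simp: polar_commute)
qed

lemma dim_orthogonal_hyperplane: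
  assumes "subspace S"
  shows "dim S \<le> dim (S \<inter> {z. polar z u = 0}) + 1"
proof -
  obtain Bs where "finite_dimensional_vector_space scale Bs" using finite_dimensional by blast
  then interpret O: finite_dimensional_vector_space scale Bs .
  show ?thesis
  proof (cases "\<forall>s\<in>S. polar s u = 0")
    case True
    then have "S \<inter> {z. polar z u = 0} = S" by blast
    then show ?thesis by simp
  next
    case False
    then obtain s where s: "s \<in> S" "polar s u \<noteq> 0" by blast
    let ?K = "S \<inter> {z. polar z u = 0}"
    have "S \<subseteq> span (insert s ?K)"
    proof
      fix x assume x: "x \<in> S"
      let ?k = "polar x u / polar s u"
      have "x - ?k *s s \<in> S" using x s assms by (simp add: subspace_diff subspace_scale)
      then have "x - ?k *s s \<in> ?K" using s by (simp add: polar_diff polar_simps)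
      then have "x - ?k *s s \<in> span ?K" by (rule span_base)
      then show "x \<in> span (insert s ?K)" unfolding span_breakdown_eq by (rule exI)
    qed
    then have "dim S \<le> dim (span (insert s ?K))" by (rule O.dim_subset)
    also have "\<dots> \<le> dim ?K + 1" by (simp add: O.dim_insert)
    finally show ?thesis .
  qed
qed

lemma dim_orthogonal_finite:
  assumes "finite X" "subspace S"
  shows "dim S \<le> dim (S \<inter> {z. \<forall>u\<in>X. polar z u = 0}) + card X"
  using assms(1)
proof induction
  case (insert u X)
  let ?K = "S \<inter> {z. \<forall>u\<in>X. polar z u = 0}"
  have "dim ?K \<le> dim (?K \<inter> {z. polar z u = 0}) + 1"
    by (intro dim_orthogonal_hyperplane subspace_inter assms(2) subspace_orthogonal)
  moreover have "?K \<inter> {z. polar z u = 0} = S \<inter> {z. \<forall>u\<in>insert u X. polar z u = 0}" by auto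
  ultimately show ?case using insert by simp
qed simp

text \<open>
  Extend a basis of \<open>W\<close> to a basis of the whole space.  A vector of \<open>U\<close> orthogonal to the added
  vectors is orthogonal to everything, so the number of added vectors bounds \<open>dim U\<close>.\<close>

lemma dim_orthogonal_pair:
  assumes U: "subspace U" and orth: "\<And>u w. u \<in> U \<Longrightarrow> w \<in> W \<Longrightarrow> polar u w = 0"
  shows "dim U + dim W \<le> 8"
proof -
  obtain Bs where "finite_dimensional_vector_space scale Bs" using finite_dimensional by blast
  then interpret O: finite_dimensional_vector_space scale Bs .
  obtain BW where BW: "BW \<subseteq> W" "independent BW" "W \<subseteq> span BW" "card BW = dim W"
    using basis_exists[of W] by metis
  define B where "B = extend_basis BW"
  have B: "BW \<subseteq> B" "independent B" "span B = UNIV"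
    using BW by (simp_all add: B_def extend_basis_superset independent_extend_basis)
  have cB: "finite B" "card B = 8"
    using B O.finiteI_independent dim_eq_card_independent[OF B(2)] dim_8 by (auto simp flip: B(3))
  have "U \<inter> {z. \<forall>u\<in>B - BW. polar z u = 0} \<subseteq> {0}"
  proof
    fix z assume z: "z \<in> U \<inter> {z. \<forall>u\<in>B - BW. polar z u = 0}"
    have "polar z x = 0" for x
      by (rule span_orthogonal[of _ B]) (use B z orth BW(1) in auto)
    then show "z \<in> {0}" using nondegenerate_polar by simp
  qed
  then have "dim (U \<inter> {z. \<forall>u\<in>B - BW. polar z u = 0}) = 0"
    using O.dim_subset[of _ "{0}"] by fastforce
  moreover have "card (B - BW) = 8 - dim W"
    using cB B BW by (simp add: card_Diff_subset finite_subset)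
  moreover have "dim W \<le> 8" using cB B BW by (metis card_mono)
  ultimately show ?thesis
    using dim_orthogonal_finite[OF finite_Diff[OF cB(1)] U, of BW] by linarith
qed

text \<open>
  Used to count dimensions by exhibiting, for each new vector, a functional that detects it.\<close>

lemma dim_insert_functional:
  assumes "\<And>s. s \<in> S \<Longrightarrow> polar y s = 0" "polar y x \<noteq> 0"
  shows "dim (insert x S) = dim S + 1"
proof -
  obtain Bs where "finite_dimensional_vector_space scale Bs" using finite_dimensional by blast
  then interpret O: finite_dimensional_vector_space scale Bs .
  have "x \<notin> span S" using span_orthogonal assms by blast
  then show ?thesis by (simp add: O.dim_insert)
qed

text \<open>
  The subspace \<open>U\<close> orthogonal to the four vectors has dimension at least four.  If \<open>N\<close> vanished on it, \<open>U\<close>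
  would be orthogonal to itself and to the plane spanned by \<open>e\<close> and \<open>a\<close>, which meets \<open>U\<close> only in zero;
  this would force \<open>2 * dim U + 2 \<le> 8\<close>.\<close>

lemma nonsingular_orthogonal:
  assumes a: "T a = 1" "N a = 0"
  obtains z where "polar z e = 0" "polar z a = 0" "polar z u = 0" "polar z v = 0" "N z \<noteq> 0"
proof -
  define X where "X = {e, a, u, v}"
  define U where "U = {z. \<forall>u\<in>X. polar z u = 0}"
  have U: "subspace U" unfolding U_def by (rule subspace_orthogonal)
  have ae: "polar a e = 1" "polar e a = 1" using a by (simp_all add: T_def polar_commute)
  have "\<exists>z\<in>U. N z \<noteq> 0"
  proof (rule ccontr)
    assume "\<not> ?thesis"
    then have N0: "N z = 0" if "z \<in> U" for z using that by blast
    have UU: "polar y z = 0" if "y \<in> U" "z \<in> U" for y z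
      using N0 that subspace_add[OF U that] by (simp add: polar_def)
    have UX: "polar z x = 0" "polar x z = 0" if "z \<in> U" "x \<in> X" for x z
      using that by (auto simp: U_def polar_commute)
    have "8 \<le> dim U + card X"
      using dim_orthogonal_finite[of X UNIV] dim_8 by (simp add: X_def U_def)
    moreover have "card X \<le> 4" unfolding X_def by (simp add: card_insert_if)
    moreover have "dim (insert a U) = dim U + 1"
      by (rule dim_insert_functional[of _ e]) (use UX ae in \<open>auto simp: X_def\<close>)
    moreover have "dim (insert e (insert a U)) = dim (insert a U) + 1"
      by (rule dim_insert_functional[of _ a]) (use UX ae a in \<open>auto simp: X_def polar_self\<close>)
    moreover have "dim U + dim (insert e (insert a U)) \<le> 8"
      by (rule dim_orthogonal_pair[OF U]) (use UX UU in \<open>auto simp: X_def\<close>)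
    ultimately show False by linarith
  qed
  then show ?thesis using that by (auto simp: U_def X_def)
qed

section \<open>Moving idempotents by automorphisms\<close>

lemma diag_comp: "diag \<kappa> \<circ> diag \<phi> = diag (\<kappa> \<circ> \<phi>)"
  by (auto simp: diag_def)

lemma G_diag_cancel:
  assumes "diag \<kappa> \<in> G" "automorphism \<phi>" "diag (\<kappa> \<circ> \<phi>) \<in> G"
  shows "diag \<phi> \<in> G"
  using assms G_cancel[of "diag \<kappa>" "diag \<phi>"] by (simp add: automorphism_def diag_comp)

lemma automorphism_comp:
  "automorphism \<kappa> \<Longrightarrow> automorphism \<phi> \<Longrightarrow> automorphism (\<kappa> \<circ> \<phi>)"
  using SE6_comp[of "diag \<kappa>" "diag \<phi>"] by (simp add: automorphism_def diag_comp)

lemma idempotent: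
  assumes "T a = 1" "N a = 0"
  shows "bar a = e - a" "a \<odot> a = a" "a \<odot> (a \<odot> z) = a \<odot> z" "bar a \<odot> (bar a \<odot> z) = bar a \<odot> z"
    "a \<odot> (bar a \<odot> z) = 0" "bar a \<odot> (a \<odot> z) = 0" "polar a (bar a) = 1" "bar a \<odot> bar a = bar a" 
proof -
  show b: "bar a = e - a" using assms by (simp add: bar_def)
  show "a \<odot> (bar a \<odot> z) = 0" "bar a \<odot> (a \<odot> z) = 0" for z using assms by simp_all
  then show 1: "a \<odot> (a \<odot> z) = a \<odot> z" "bar a \<odot> (bar a \<odot> z) = bar a \<odot> z" for z
    by (simp_all add: b mul_diff unit_left)
  show "a \<odot> a = a" "bar a \<odot> bar a = bar a" using 1(1)[of e] 1(2)[of e] by (simp_all add: unit_right)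
  show "polar a (bar a) = 1" using assms by (simp add: b polar_diff polar_self T_def[symmetric])
qed

text \<open>
  Since \<open>polar a b\<close> is non-zero, so is the norm of \<open>x = a - b\<close>, and the reflection in \<open>x\<close>
  sends \<open>b\<close> to \<open>a\<close>; a second reflection in some \<open>y\<close> orthogonal to \<open>b\<close> makes this an element of \<open>G\<close>, but on the first octonion entry it moves \<open>e\<close> to \<open>w / n\<close>.  A second pair \<open>z\<close>,
  \<open>t\<close>, with \<open>t\<close> chosen so that \<open>t \<odot> w = n *s z\<close>, moves \<open>w / n\<close> back to \<open>e\<close>.  It leaves \<open>a\<close> and
  \<open>e\<close> fixed on the third entry if \<open>z\<close> is orthogonal to \<open>e\<close>, \<open>a\<close>, \<open>w\<close> and \<open>a \<odot> w\<close>, and such a \<open>z\<close>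
  exists by \<open>nonsingular_orthogonal\<close>.\<close>

lemma move_idempotent:
  assumes a: "T a = 1" "N a = 0" and b: "T b = 1" "N b = 0" and ab: "polar a b \<noteq> 0"
  obtains \<kappa> where "automorphism \<kappa>" "diag \<kappa> \<in> G" "\<kappa> b = a"
proof -
  define x where "x = a - b"
  define n where "n = N x"
  have n: "n = - polar a b" "n \<noteq> 0" using ab a b by (simp_all add: n_def x_def N_diff)
  have x: "polar e x = 0" using a b by (simp add: x_def polar_diff T_def polar_commute)
  obtain z0 where z0: "polar z0 e = 0" "polar z0 b = 0" "N z0 \<noteq> 0"
    using nonsingular_orthogonal[OF b] by metis
  \<comment> \<open>The span of \<open>e\<close> and \<open>b\<close> contains an element of any prescribed norm, and multiplying
    \<open>z0\<close> by it stays orthogonal to that plane; this adjusts the norm of \<open>y\<close> to \<open>n\<close>.\<close>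
  define k where "k = b + (n / N z0) *s bar b"
  define y where "y = k \<odot> z0"
  have "N k = n / N z0" using b idempotent(7)[OF b] by (simp add: k_def linear_simps)
  then have Ny: "N y = n" using z0 by (simp add: y_def N_mul)
  have kb: "bar k = bar b + (n / N z0) *s b" "bar k \<odot> b = (n / N z0) *s b"
    using b by (simp_all add: k_def linear_simps idempotent(2)[OF b])
  have ye: "polar e y = 0" using z0
    by (simp add: y_def polar_commute[of e] polar_mul_left unit_right kb(1) linear_simps idempotent(1)[OF b])
  have yb: "polar b y = 0" using z0
    by (simp add: y_def polar_commute[of b] polar_mul_left kb(2) linear_simps)
  define w where "w = bar x \<odot> y"
  have Nw: "N w = n * n" by (simp add: w_def N_mul Ny n_def)
  obtain z where z: "polar z e = 0" "polar z a = 0" "polar z w = 0" "polar z (a \<odot> w) = 0" "N z \<noteq> 0"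
    using nonsingular_orthogonal[OF a] by metis
  define t where "t = (1 / n) *s (z \<odot> bar w)"
  have Nt: "N t = N z" using n by (simp add: t_def linear_simps N_mul Nw power2_eq_square)
  have t: "polar e t = 0" "polar a t = 0"
    using z by (simp_all add: t_def polar_commute[of e] polar_commute[of a] linear_simps polar_mul_right unit_left)
  have tw: "t \<odot> w = n *s z" using n by (simp add: t_def linear_simps Nw)
  obtain h1 where h1: "h1 \<in> G" "\<And>a b c A B C. h1 (a, b, c, A, B, C) =
    (a, b, c, (1 / N x) *s (bar x \<odot> (y \<odot> A)), (1 / N x) *s ((B \<odot> y) \<odot> bar x),
     reflection x (reflection y C))"
    using reflection_pair[of x y] Ny n n_def by auto
  obtain h2 where h2: "h2 \<in> G" "\<And>a b c A B C. h2 (a, b, c, A, B, C) =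
    (a, b, c, (1 / N z) *s (bar z \<odot> (t \<odot> A)), (1 / N z) *s ((B \<odot> t) \<odot> bar z),
     reflection z (reflection t C))"
    using reflection_pair[of z t] Nt z by auto
  have 1: "h1 (0, 0, 0, e, 0, 0) = (0, 0, 0, (1 / n) *s w, 0, 0)"
    "h1 (0, 0, 0, 0, 0, e) = (0, 0, 0, 0, 0, e)" "h1 (0, 0, 0, 0, 0, b) = (0, 0, 0, 0, 0, a)"
  proof -
    have "polar b x = - n" using n b by (simp add: x_def polar_diff polar_self polar_commute)
    moreover have "reflection x b = b - (polar b x / n) *s x" by (simp add: reflection_def n_def)
    ultimately have "reflection x b = a" using n by (simp add: x_def scale_minus_left)
    moreover have "reflection y b = b" "reflection y e = e" "reflection x e = e" "reflection x 0 = 0" "reflection y 0 = 0"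
      by (simp_all add: reflection_def yb ye x)
    ultimately show "h1 (0, 0, 0, e, 0, 0) = (0, 0, 0, (1 / n) *s w, 0, 0)"
      "h1 (0, 0, 0, 0, 0, e) = (0, 0, 0, 0, 0, e)" "h1 (0, 0, 0, 0, 0, b) = (0, 0, 0, 0, 0, a)"
      by (simp_all add: h1 unit_right w_def n_def)
  qed
  have 2: "h2 (0, 0, 0, (1 / n) *s w, 0, 0) = (0, 0, 0, e, 0, 0)"
    "h2 (0, 0, 0, 0, 0, e) = (0, 0, 0, 0, 0, e)" "h2 (0, 0, 0, 0, 0, a) = (0, 0, 0, 0, 0, a)"
  proof -
    have "reflection t a = a" "reflection t e = e" "reflection z e = e" "reflection z a = a"
       "reflection z 0 = 0" "reflection t 0 = 0"
      using z by (simp_all add: reflection_def t polar_commute[of e z] polar_commute[of a z])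
    then show "h2 (0, 0, 0, (1 / n) *s w, 0, 0) = (0, 0, 0, e, 0, 0)"
      "h2 (0, 0, 0, 0, 0, e) = (0, 0, 0, 0, 0, e)" "h2 (0, 0, 0, 0, 0, a) = (0, 0, 0, 0, 0, a)"
      using z n by (simp_all add: h2 mul_simps tw)
  qed
  have h: "h2 \<circ> h1 \<in> G" using h1 h2 by (simp add: G_comp)
  have r0: "reflection u 0 = 0" for u by (simp add: reflection_def)
  obtain \<kappa> where \<kappa>: "automorphism \<kappa>" "h2 \<circ> h1 = diag \<kappa>"
    by (rule automorphism_frame[OF G_SE6[OF h]]) (simp_all add: 1 2, simp_all add: h1 h2 r0)
  have "diag \<kappa> (0, 0, 0, 0, 0, b) = (0, 0, 0, 0, 0, a)" unfolding \<kappa>(2)[symmetric] by (simp add: 1 2)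
  then have "\<kappa> b = a" by (simp add: diag_def)
  with \<kappa> h that show ?thesis by metis
qed

end

section \<open>Automorphisms fixing an idempotent\<close>

text \<open>
  The eight vectors \<open>a\<close>, \<open>bar a\<close>, \<open>v i\<close>, \<open>w i\<close> form a hyperbolic basis adapted to the Peirce
  decomposition with respect to the idempotent \<open>a\<close>; that they span is expressed by
  \<open>separating\<close>.  Of the multiplication table only the relation \<open>v2\<close> is recorded: it makes the
  third basis vector depend on the first two pairs, which is why automorphisms fixing \<open>a\<close> have
  determinant one on the span of the \<open>v i\<close>.\<close>

locale peirce_basis = octonion_algebra +
  fixes a :: 'b and v w :: "nat \<Rightarrow> 'b" and k0 k1 :: 'a
  assumes Ta: "T a = 1" and Na: "N a = 0"
    and v: "\<And>i. i < 3 \<Longrightarrow> a \<odot> v i = v i \<and> T (v i) = 0"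
    and w: "\<And>i. i < 3 \<Longrightarrow> bar a \<odot> w i = w i \<and> T (w i) = 0"
    and dual: "\<And>i j. i < 3 \<Longrightarrow> j < 3 \<Longrightarrow> polar (v i) (w j) = (if i = j then 1 else 0)"
    and v2: "v 2 = a \<odot> ((v 0 + k0 *s w 0) \<odot> (v 1 + k1 *s w 1))"
    and separating: "\<And>x. \<lbrakk>polar x a = 0; polar x (bar a) = 0; \<And>i. i < 3 \<Longrightarrow> polar x (v i) = 0;
      \<And>i. i < 3 \<Longrightarrow> polar x (w i) = 0\<rbrakk> \<Longrightarrow> x = 0"

context octonion_algebra
begin

text \<open>
  The Cayley--Dickson construction: \<open>z0\<close> orthogonal to the plane of \<open>e\<close> and \<open>a\<close>, then \<open>z1\<close> orthogonal to
  the quaternion algebra generated by \<open>a\<close> and \<open>z0\<close>, and finally \<open>z0 \<odot> z1\<close>.  Multiplying each by \<open>a\<close>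
  and \<open>bar a\<close> splits it into a hyperbolic pair.\<close>

lemma peirce_basis_exists:
  assumes a: "T a = 1" "N a = 0"
  shows "\<exists>v w k0 k1. peirce_basis scale mul e N a v w k0 k1"
proof -
  note idem = idempotent[OF a]
  have pe: "polar e a = 1" "polar e (bar a) = 1" "polar e e = 2" "polar a a = 0" "polar (bar a) (bar a) = 0"
    "polar (bar a) a = 1"
    using a idem(7) by (simp_all add: T_def[symmetric] polar_commute[of e] polar_self N_e T_e polar_commute[of "bar a" a])
  obtain z0 where z0: "polar z0 e = 0" "polar z0 a = 0" "N z0 \<noteq> 0"
    using nonsingular_orthogonal[OF a] by metis
  obtain z1 where z1: "polar z1 e = 0" "polar z1 a = 0" "polar z1 z0 = 0" "polar z1 (a \<odot> z0) = 0" "N z1 \<noteq> 0"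
    using nonsingular_orthogonal[OF a] by metis
  define z where "z = (\<lambda>i::nat. if i = 0 then z0 else if i = 1 then z1 else z0 \<odot> z1)"
  have z_simps: "z 0 = z0" "z 1 = z1" "z (Suc 0) = z1" "z 2 = z0 \<odot> z1" by (simp_all add: z_def)
  have comm: "a \<odot> y = y \<odot> bar a" if "polar y e = 0" "polar y a = 0" for y
  proof -
    have y: "bar y = - y" using that by (simp add: bar_def T_def)
    have "T (a \<odot> y) = 0" using that by (simp add: T_mul_polar y polar_commute[of a])
    then have "bar (a \<odot> y) = - (a \<odot> y)" by (simp add: bar_def)
    then show ?thesis by (simp add: bar_mul y)
  qed
  have lt3: "i = 0 \<or> i = 1 \<or> i = 2" if "i < 3" for i :: nat using that by auto
  have barz0: "bar z0 = - z0" using z0 by (simp add: bar_def T_def)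
  have zz: "polar (z0 \<odot> z1) z0 = 0" "polar (z0 \<odot> z1) z1 = 0" "polar (z0 \<odot> z1) e = 0" "polar (z0 \<odot> z1) a = 0"
    "polar (z0 \<odot> z1) (a \<odot> z0) = 0" "polar (z0 \<odot> z1) (a \<odot> z1) = 0"
  proof -
    show "polar (z0 \<odot> z1) z0 = 0" using z1 by (simp add: polar_mul_left polar_scale_right)
    show "polar (z0 \<odot> z1) z1 = 0" using z0 by (simp add: polar_mul_right polar_scale_right)
    show "polar (z0 \<odot> z1) e = 0" using z1 by (simp add: polar_mul_left unit_right barz0)
    have "polar z1 (z0 \<odot> a) = 0"
    proof -
      have "z0 \<odot> a = z0 - z0 \<odot> bar a" by (simp add: idem(1) mul_diff unit_right)
      then show ?thesis using z1 comm[of z0] z0 by (simp add: polar_diff)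
    qed
    then show "polar (z0 \<odot> z1) a = 0" by (simp add: polar_mul_left barz0)
    show "polar (z0 \<odot> z1) (a \<odot> z1) = 0" using z0 by (simp add: polar_mul_same)
    show "polar (z0 \<odot> z1) (a \<odot> z0) = 0"
      using comm[of z0] z0 z1 by (simp add: polar_mul_same idem(1) polar_diff)
  qed
  have zK: "polar (z i) e = 0" "polar (z i) a = 0" if "i < 3" for i
    using lt3[OF that] z0 z1 zz by (auto simp: z_simps)
  have Nz: "N (z i) \<noteq> 0" if "i < 3" for i
    using lt3[OF that] z0 z1 by (auto simp: z_simps N_mul)
  have swap: "polar x (a \<odot> y) = polar x y - polar (a \<odot> x) y" for x y
  proof -
    have "polar x (a \<odot> y) = polar (bar a \<odot> x) y" by (metis polar_mul_left polar_commute)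
    then show ?thesis by (simp add: idem(1) mul_diff unit_left polar_diff)
  qed
  have orth: "polar z0 z1 = 0" "polar z0 (z0 \<odot> z1) = 0" "polar z1 (z0 \<odot> z1) = 0"
    "polar (a \<odot> z0) z1 = 0" "polar (a \<odot> z0) (z0 \<odot> z1) = 0" "polar (a \<odot> z1) (z0 \<odot> z1) = 0"
    by (subst polar_commute, fact)+
  have off: "polar (z i) (z j) = 0 \<and> polar (z i) (a \<odot> z j) = 0" if "i < 3" "j < 3" "i \<noteq> j" for i j
    using lt3[OF that(1)] lt3[OF that(2)] that(3)
    by (elim disjE) (simp_all add: z_simps orth zz z1 swap[of z0 z1] swap[of z0 "z0 \<odot> z1"] swap[of z1 "z0 \<odot> z1"])
  define v where "v i = a \<odot> z i" for i
  define w where "w i = (1 / N (z i)) *s (bar a \<odot> z i)" for i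
  have dual: "polar (v i) (w j) = (if i = j then 1 else 0)" if "i < 3" "j < 3" for i j
  proof -
    have "polar (v i) (w j) = polar (z i) (bar a \<odot> z j) / N (z j)"
      by (simp add: v_def w_def polar_scale_right polar_mul_left idem(4))
    also have "polar (z i) (bar a \<odot> z j) = (if i = j then N (z j) else 0)"
    proof (cases "i = j")
      case True
      then show ?thesis using polar_mul_same(2)[of e "z j" "bar a"] by (simp add: unit_left pe)
    qed (use off[OF that] in \<open>simp add: idem(1) mul_diff unit_left polar_diff\<close>)
    finally show ?thesis using Nz[OF that(2)] by simp
  qed
  have vv: "polar (v i) (v j) = 0" "polar (w i) (w j) = 0" for i j
    using a by (simp_all add: v_def w_def linear_simps polar_mul_same)
  have vK: "polar (v i) a = 0" "polar (v i) (bar a) = 0" "polar (w i) a = 0" "polar (w i) (bar a) = 0"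
    if "i < 3" for i
  proof -
    have "polar (z i) (bar a) = 0" using zK[OF that] by (simp add: idem(1) polar_diff)
    then show "polar (v i) a = 0" "polar (v i) (bar a) = 0" "polar (w i) a = 0" "polar (w i) (bar a) = 0"
      using zK[OF that] a
      by (simp_all add: v_def w_def polar_simps polar_mul_left idem(2) idem(8) polar_scale_right)
  qed
  have dual': "polar (w i) (v j) = (if i = j then 1 else 0)" if "i < 3" "j < 3" for i j
    using dual[OF that(2,1)] by (simp add: polar_commute)
  have Kv: "polar a (v i) = 0" "polar (bar a) (v i) = 0" "polar a (w i) = 0" "polar (bar a) (w i) = 0"
    if "i < 3" for i
    using vK[OF that] by (simp_all add: polar_commute)
  have "peirce_basis scale mul e N a v w (N z0) (N z1)"
  proof
    show "T a = 1" "N a = 0" by (fact a)+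
    fix i :: nat assume i: "i < 3"
    show "a \<odot> v i = v i \<and> T (v i) = 0" "bar a \<odot> w i = w i \<and> T (w i) = 0"
    proof -
      have "T (v i) = 0" "T (w i) = 0" using vK[OF i] by (simp_all add: T_def idem(1) polar_diff)
      then show "a \<odot> v i = v i \<and> T (v i) = 0" "bar a \<odot> w i = w i \<and> T (w i) = 0"
        by (simp_all add: v_def w_def idem(3) idem(4) mul_simps)
    qed
  next
    fix i j :: nat assume "i < 3" "j < 3"
    then show "polar (v i) (w j) = (if i = j then 1 else 0)" by (rule dual)
  next
    have "v 0 + N z0 *s w 0 = z0" "v 1 + N z1 *s w 1 = z1"
      using z0 z1 by (simp_all add: v_def w_def z_simps idem(1) mul_diff unit_left)
    then show "v 2 = a \<odot> ((v 0 + N z0 *s w 0) \<odot> (v 1 + N z1 *s w 1))"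
      by (simp add: v_def z_simps)
  next
    fix x assume x: "polar x a = 0" "polar x (bar a) = 0" "\<And>i. i < 3 \<Longrightarrow> polar x (v i) = 0"
      "\<And>i. i < 3 \<Longrightarrow> polar x (w i) = 0"
    show "x = 0"
    proof (rule ccontr)
      assume "x \<noteq> 0"
      then obtain y where y: "polar y x \<noteq> 0" using nondegenerate_polar by (metis polar_commute)
      define B where "B = {a, bar a, v 0, w 0, v 1, w 1, v 2, w 2}"
      have dim0: "dim {} = 0" using dim_eq_card_independent[OF independent_empty] by simp
      have "dim {w 2} = 1" by (subst dim_insert_functional[of _ "v 2"]) (auto simp: dual dim0)
      then have "dim {v 2, w 2} = 2"
        by (subst dim_insert_functional[of _ "w 2"]) (auto simp: dual' vv)
      then have "dim {w 1, v 2, w 2} = 3"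
        by (subst dim_insert_functional[of _ "v 1"]) (auto simp: dual vv)
      then have "dim {v 1, w 1, v 2, w 2} = 4"
        by (subst dim_insert_functional[of _ "w 1"]) (auto simp: dual' vv)
      then have "dim {w 0, v 1, w 1, v 2, w 2} = 5"
        by (subst dim_insert_functional[of _ "v 0"]) (auto simp: dual vv)
      then have "dim {v 0, w 0, v 1, w 1, v 2, w 2} = 6"
        by (subst dim_insert_functional[of _ "w 0"]) (auto simp: dual' vv)
      then have "dim {bar a, v 0, w 0, v 1, w 1, v 2, w 2} = 7"
        by (subst dim_insert_functional[of _ "a"]) (auto simp: Kv idem(7))
      then have "dim B = 8" unfolding B_def
        by (subst dim_insert_functional[of _ "bar a"]) (auto simp: Kv pe)
      moreover have "dim (span {x}) = 1"
        using dim_insert_functional[of "{}" y x] y dim0 by simp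
      moreover have "dim (span {x}) + dim B \<le> 8"
      proof (rule dim_orthogonal_pair)
        fix u b assume "u \<in> span {x}" "b \<in> B"
        moreover have "polar b x = 0" if "b \<in> B"
          using that x by (auto simp: B_def polar_commute[of _ x])
        ultimately show "polar u b = 0" using span_orthogonal[of u "{x}" b] by (simp add: polar_commute)
      qed simp
      ultimately show False by simp
    qed
  qed
  then show ?thesis by blast
qed

end

context peirce_basis
begin

lemmas idem = idempotent[OF Ta Na]

lemma isotropic: "a \<odot> x = x \<Longrightarrow> a \<odot> y = y \<Longrightarrow> polar x y = 0"
    "bar a \<odot> x = x \<Longrightarrow> bar a \<odot> y = y \<Longrightarrow> polar x y = 0"
  using polar_mul_same(1)[of a x y] polar_mul_same(1)[of "bar a" x y] Na by simp_all

lemma isotropic_N: "a \<odot> x = x \<Longrightarrow> N x = 0" "bar a \<odot> x = x \<Longrightarrow> N x = 0"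
  using N_mul[of a x] N_mul[of "bar a" x] Na by simp_all

lemma orthogonal_idempotent:
  assumes "T x = 0"
  shows "a \<odot> x = x \<Longrightarrow> polar x a = 0 \<and> polar x (bar a) = 0"
    "bar a \<odot> x = x \<Longrightarrow> polar x a = 0 \<and> polar x (bar a) = 0"
  using isotropic(1)[of x a] isotropic(2)[of x "bar a"] idem(2,8) assms
  by (auto simp: T_def idem(1) polar_diff)

text \<open>
  By linearised alternativity \<open>x \<odot> y\<close> is fixed by multiplication by \<open>a\<close> on both sides.  Its trace is
  \<open>- polar x y = 0\<close>, so conjugation turns the identity on the right into the same identity on the left
  for \<open>bar a\<close>; but \<open>a\<close> and \<open>bar a\<close> annihilate each other.\<close>

lemma product_zero:
  assumes x: "a \<odot> x = x" "T x = 0" and y: "bar a \<odot> y = y" "T y = 0" and xy: "polar x y = 0"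
  shows "x \<odot> y = 0"
proof -
  have bx: "bar x = - x" "bar y = - y" using x y by (simp_all add: bar_def)
  have xa: "polar x a = 0" "polar a y = 0"
    using orthogonal_idempotent(1)[OF x(2,1)] orthogonal_idempotent(2)[OF y(2,1)] by (auto simp: polar_commute)
  have 1: "a \<odot> (x \<odot> y) = x \<odot> y"
    using alternative_linearized_bar(1)[of x a y] by (simp add: xa y bx)
  have "a \<odot> x = x \<odot> bar a"
  proof -
    have "bar (a \<odot> x) = - (a \<odot> x)" using x by (simp add: bx)
    then show ?thesis by (simp add: bar_mul bx)
  qed
  then have "x \<odot> bar a = x" using x by simp
  then have 2: "(x \<odot> y) \<odot> a = x \<odot> y"
    using alternative_linearized_bar(2)[of x a y] by (simp add: xa bx)
  have "T (x \<odot> y) = 0" using xy by (simp add: T_mul_polar bx)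
  then have "bar (x \<odot> y) = - (x \<odot> y)" by (simp add: bar_def)
  then have "bar a \<odot> (x \<odot> y) = x \<odot> y" using arg_cong[OF 2, of bar] by (simp add: bar_mul)
  with 1 idem(5)[of "x \<odot> y"] show ?thesis by simp
qed

definition H :: "('b \<Rightarrow> 'b) set" where
  "H = {\<kappa>. automorphism \<kappa> \<and> diag \<kappa> \<in> G \<and> \<kappa> a = a}"

lemma H_comp: "\<kappa> \<in> H \<Longrightarrow> \<phi> \<in> H \<Longrightarrow> \<kappa> \<circ> \<phi> \<in> H"
  using G_comp[of "diag \<kappa>" "diag \<phi>"] by (simp add: H_def automorphism_comp diag_comp)

lemma id_H: "id \<in> H"
proof -
  have "diag id = id" by (auto simp: diag_def)
  then show ?thesis using id_G G_SE6[OF id_G] by (simp add: H_def automorphism_def)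
qed

text \<open>
  For \<open>x \<odot> y = 0\<close> the Eichler transformation fixes \<open>e\<close> on the first octonion entry as well as on the
  third, and is therefore an automorphism.  On the Peirce space of \<open>a\<close> it is a transvection.\<close>

lemma transvection:
  assumes x: "a \<odot> x = x" "T x = 0" and y: "bar a \<odot> y = y" "T y = 0" and xy: "polar x y = 0"
  shows "\<exists>\<kappa>\<in>H. \<forall>z. \<kappa> z = z + polar z y *s x - polar z x *s y"
proof -
  have bx: "bar x = - x" using x by (simp add: bar_def)
  obtain h where h: "h \<in> G" "\<And>a b c A B C. h (a, b, c, A, B, C) =
    (a, b, c, A + bar x \<odot> (y \<odot> A), B - (B \<odot> x) \<odot> bar y, C + polar C y *s x - polar C x *s y)"
    using eichler[OF isotropic_N(1)[OF x(1)] isotropic_N(2)[OF y(1)] xy] by blast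
  have e0: "polar e x = 0" "polar e y = 0" using x y by (simp_all add: T_def polar_commute)
  have a0: "polar a x = 0" "polar a y = 0"
    using orthogonal_idempotent(1)[OF x(2,1)] orthogonal_idempotent(2)[OF y(2,1)]
    by (auto simp: polar_commute)
  obtain \<kappa> where \<kappa>: "automorphism \<kappa>" "h = diag \<kappa>"
    by (rule automorphism_frame[OF G_SE6[OF h(1)]])
      (simp_all add: h(2) e0 bx unit_right product_zero[OF assms])
  have \<kappa>z: "\<kappa> z = z + polar z y *s x - polar z x *s y" for z
    using h(2)[of 0 0 0 0 0 z] by (simp add: \<kappa>(2) diag_def)
  then have "\<kappa> \<in> H" using \<kappa> h by (simp add: H_def a0)
  with \<kappa>z show ?thesis by blast
qed

definition vec :: "(nat \<Rightarrow> 'a) \<Rightarrow> 'b" where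
  "vec c = c 0 *s v 0 + c 1 *s v 1 + c 2 *s v 2"

lemma lt3: "i < 3 \<longleftrightarrow> i = 0 \<or> i = 1 \<or> i = (2::nat)" by auto

lemma vec_V: "a \<odot> vec c = vec c" "T (vec c) = 0"
  using v[of 0] v[of 1] v[of 2] by (simp_all add: vec_def mul_simps T_simps)

lemma vec_coordinate: "i < 3 \<Longrightarrow> polar (vec c) (w i) = c i"
  by (auto simp: lt3 vec_def polar_simps dual)

lemma vec_expansion:
  assumes "a \<odot> x = x" "T x = 0"
  shows "x = vec (\<lambda>i. polar x (w i))"
proof -
  have "x - vec (\<lambda>i. polar x (w i)) = 0"
  proof (rule separating)
    fix i :: nat assume i: "i < 3"
    show "polar (x - vec (\<lambda>i. polar x (w i))) (w i) = 0" using i by (simp add: polar_diff vec_coordinate)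
    show "polar (x - vec (\<lambda>i. polar x (w i))) (v i) = 0"
      using isotropic(1) assms vec_V v[OF i] by (simp add: polar_diff)
  qed (use orthogonal_idempotent(1) assms vec_V in \<open>simp_all add: polar_diff\<close>)
  then show ?thesis by simp
qed

definition move :: "'b set \<Rightarrow> 'b \<Rightarrow> 'b \<Rightarrow> bool" where
  "move S x y \<longleftrightarrow> (\<exists>\<kappa>\<in>H. (\<forall>s\<in>S. \<kappa> s = s) \<and> \<kappa> x = y)"

lemma move_trans [trans]: "move S x y \<Longrightarrow> move S y z \<Longrightarrow> move S x z"
  unfolding move_def using H_comp by (metis comp_apply)

text \<open>
  One step of Gaussian elimination: a non-zero coordinate \<open>j\<close> allows any other coordinate to be set
  to any value, by a transvection that fixes every \<open>v k\<close> with \<open>k \<noteq> j\<close>.\<close>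

lemma move_step:
  assumes ij: "i < 3" "j < 3" "i \<noteq> j" and cj: "c j \<noteq> 0" and S: "S \<subseteq> v ` ({..<3} - {j})"
  shows "move S (vec c) (vec (c(i := t)))"
proof -
  let ?x = "((t - c i) / c j) *s v i"
  have "a \<odot> ?x = ?x" "T ?x = 0" "polar ?x (w j) = 0"
    using v[OF ij(1)] ij by (simp_all add: mul_simps T_simps polar_simps dual)
  from transvection[OF this(1,2) _ _ this(3)] w[OF ij(2)] obtain \<kappa> where
    \<kappa>: "\<kappa> \<in> H" "\<And>z. \<kappa> z = z + polar z (w j) *s ?x - polar z ?x *s w j" by blast
  have "\<kappa> s = s" if s: "s \<in> S" for s
  proof -
    obtain k where k: "s = v k" "k < 3" "k \<noteq> j" using s S by auto
    then have "polar (v k) (v i) = 0" using isotropic(1) v ij by blast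
    then show ?thesis using k ij by (simp add: \<kappa>(2) dual polar_scale_right)
  qed
  moreover have "\<kappa> (vec c) = vec (c(i := t))"
  proof -
    have "polar (vec c) (v i) = 0" using isotropic(1) v ij vec_V by blast
    then have "\<kappa> (vec c) = vec c + (t - c i) *s v i"
      using ij cj by (simp add: \<kappa>(2) vec_coordinate polar_scale_right)
    also have "\<dots> = vec (c(i := t))"
      using ij(1) by (auto simp: lt3 vec_def scale_left_diff_distrib algebra_simps)
    finally show ?thesis .
  qed
  ultimately show ?thesis using \<kappa>(1) unfolding move_def by blast
qed

lemma move_refl: "move S x x"
  unfolding move_def using id_H by (metis id_apply)

text \<open>
  Elimination pivots on coordinate one or two, made non-zero first if necessary, to set coordinate
  zero to one, and then clears the others with it.  In the next two lemmas fewer pivots are available, since the basis vectors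
  already in place must stay fixed.\<close>

lemma move_v0:
  assumes "c 0 \<noteq> 0 \<or> c 1 \<noteq> 0 \<or> c 2 \<noteq> 0"
  shows "move {} (vec c) (v 0)"
proof -
  have 1: "\<exists>c' j. move {} (vec c) (vec c') \<and> (j = 1 \<or> j = 2) \<and> c' j \<noteq> 0"
  proof (cases "c 1 = 0 \<and> c 2 = 0")
    case True
    then have "move {} (vec c) (vec (c(1 := 1)))" using assms by (intro move_step[of 1 0]) auto
    then show ?thesis by (intro exI[of _ "c(1 := 1)"] exI[of _ 1]) simp
  next
    case False
    then show ?thesis using move_refl by blast
  qed
  then obtain c' j where c': "move {} (vec c) (vec c')" "j = 1 \<or> j = 2" "c' j \<noteq> 0" by blast
  note c'(1)
  also have "move {} (vec c') (vec (c'(0 := 1)))" by (rule move_step[of 0 j]) (use c' in auto)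
  also have "move {} (vec (c'(0 := 1))) (vec (c'(0 := 1, 1 := 0)))" by (rule move_step[of 1 0]) auto
  also have "move {} (vec (c'(0 := 1, 1 := 0))) (vec (c'(0 := 1, 1 := 0, 2 := 0)))" by (rule move_step[of 2 0]) auto
  also have "vec (c'(0 := 1, 1 := 0, 2 := 0)) = v 0" by (simp add: vec_def)
  finally show ?thesis .
qed

lemma move_v1:
  assumes "c 1 \<noteq> 0 \<or> c 2 \<noteq> 0"
  shows "move {v 0} (vec c) (v 1)"
proof -
  have S: "{v 0} \<subseteq> v ` ({..<3} - {1})" "{v 0} \<subseteq> v ` ({..<3} - {2})" by auto
  have 1: "\<exists>c'. move {v 0} (vec c) (vec c') \<and> c' 2 \<noteq> 0"
  proof (cases "c 2 = 0")
    case True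
    then have "move {v 0} (vec c) (vec (c(2 := 1)))" using assms S by (intro move_step[of 2 1]) auto
    then show ?thesis by (intro exI[of _ "c(2 := 1)"]) simp
  next
    case False
    then show ?thesis using move_refl by blast
  qed
  then obtain c' where c': "move {v 0} (vec c) (vec c')" "c' 2 \<noteq> 0" by blast
  note c'(1)
  also have "move {v 0} (vec c') (vec (c'(1 := 1)))" by (rule move_step[of 1 2]) (use c' S in auto)
  also have "move {v 0} (vec (c'(1 := 1))) (vec (c'(1 := 1, 2 := 0)))"
    by (rule move_step[of 2 1]) (use S in auto)
  also have "move {v 0} (vec (c'(1 := 1, 2 := 0))) (vec (c'(1 := 1, 2 := 0, 0 := 0)))"
    by (rule move_step[of 0 1]) (use S in auto)
  also have "vec (c'(1 := 1, 2 := 0, 0 := 0)) = v 1" by (simp add: vec_def)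
  finally show ?thesis .
qed

lemma move_v2:
  assumes "c 2 \<noteq> 0"
  shows "move {v 0, v 1} (vec c) (c 2 *s v 2)"
proof -
  have S: "{v 0, v 1} \<subseteq> v ` ({..<3} - {2})" by auto
  have "move {v 0, v 1} (vec c) (vec (c(0 := 0)))" by (rule move_step[of 0 2]) (use assms S in auto)
  also have "move {v 0, v 1} (vec (c(0 := 0))) (vec (c(0 := 0, 1 := 0)))"
    by (rule move_step[of 1 2]) (use assms S in auto)
  also have "vec (c(0 := 0, 1 := 0)) = c 2 *s v 2" by (simp add: vec_def)
  finally show ?thesis .
qed

lemma automorphism_V:
  assumes "automorphism \<phi>" "\<phi> a = a" "i < 3"
  shows "\<phi> (v i) = vec (\<lambda>j. polar (\<phi> (v i)) (w j))"
proof (rule vec_expansion)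
  note \<phi> = automorphism_properties[OF assms(1)]
  show "a \<odot> \<phi> (v i) = \<phi> (v i)" using \<phi>(8)[of a "v i"] v[OF assms(3)] assms(2) by simp
  show "T (\<phi> (v i)) = 0" using \<phi>(6) v[OF assms(3)] by simp
qed

lemma automorphism_inj:
  assumes "automorphism \<phi>" "\<phi> x = \<phi> y"
  shows "x = y"
  by (rule polar_ext) (metis assms automorphism_properties(5))

text \<open>
  By duality \<open>\<phi>\<close> fixes \<open>w 0\<close> and \<open>w 1\<close> as well, hence also \<open>v 2\<close>, which is a
  product of \<open>a\<close> with sums of these and \<open>v 0\<close>, \<open>v 1\<close>.  So \<open>d = 1\<close>, and the whole basis is fixed.\<close>

lemma fixes_basis:
  assumes \<phi>: "automorphism \<phi>" "\<phi> a = a" and v01: "\<phi> (v 0) = v 0" "\<phi> (v 1) = v 1"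
    and d: "\<phi> (v 2) = d *s v 2" "d \<noteq> 0"
  shows "\<phi> = id"
proof -
  note p = automorphism_properties[OF \<phi>(1)]
  have abar: "\<phi> (bar a) = bar a" by (simp add: p \<phi>)
  have w_fixed: "\<phi> (w i) = w i" if i: "i < 3" and eq: "polar (\<phi> (w i)) (v 2) = polar (w i) (v 2)" for i
  proof -
    have "\<phi> (w i) - w i = 0"
    proof (rule separating)
      show "polar (\<phi> (w i) - w i) a = 0" "polar (\<phi> (w i) - w i) (bar a) = 0"
        using p(5)[of "w i" a] p(5)[of "w i" "bar a"] by (simp_all add: polar_diff \<phi> abar)
      fix j :: nat assume j: "j < 3"
      show "polar (\<phi> (w i) - w i) (v j) = 0"
        using j eq p(5)[of "w i" "v 0"] p(5)[of "w i" "v 1"] by (auto simp: lt3 polar_diff v01 simp del: One_nat_def)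
      have "bar a \<odot> \<phi> (w i) = \<phi> (w i)" using p(8)[of "bar a" "w i"] w[OF i] abar by simp
      then show "polar (\<phi> (w i) - w i) (w j) = 0"
        using isotropic(2) w[OF i] w[OF j] by (simp add: polar_diff)
    qed
    then show ?thesis by simp
  qed
  have w01: "\<phi> (w i) = w i" if i: "i = 0 \<or> i = 1" for i
  proof (rule w_fixed)
    show "i < 3" using i by auto
    have "d * polar (\<phi> (w i)) (v 2) = polar (w i) (v 2)"
      using p(5)[of "w i" "v 2"] by (simp add: d polar_scale_right)
    moreover have "polar (w i) (v 2) = 0" using i dual[of 2 i] by (auto simp: polar_commute)
    ultimately show "polar (\<phi> (w i)) (v 2) = polar (w i) (v 2)" using d by simp
  qed
  have v2': "\<phi> (v 2) = v 2"
  proof -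
    have "\<phi> (w 0) = w 0" "\<phi> (w 1) = w 1" using w01 by blast+
    then show ?thesis unfolding v2 by (simp only: p(8) p(2) p(3) \<phi> v01)
  qed
  have w2: "\<phi> (w 2) = w 2" using w_fixed[of 2] p(5)[of "w 2" "v 2"] v2' by simp
  show ?thesis
  proof
    fix x
    have "\<phi> x - x = 0"
    proof (rule separating)
      show "polar (\<phi> x - x) a = 0" "polar (\<phi> x - x) (bar a) = 0"
        using p(5)[of x a] p(5)[of x "bar a"] by (simp_all add: polar_diff \<phi> abar)
      fix j :: nat assume j: "j < 3"
      then have "\<phi> (v j) = v j" "\<phi> (w j) = w j" using v01 v2' w01 w2 by (auto simp: lt3)
      then show "polar (\<phi> x - x) (v j) = 0" "polar (\<phi> x - x) (w j) = 0"
        using p(5)[of x "v j"] p(5)[of x "w j"] by (simp_all add: polar_diff)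
    qed
    then show "\<phi> x = id x" by simp
  qed
qed

lemma automorphism_H_step:
  assumes \<phi>: "automorphism \<phi>" "\<phi> a = a" and S: "\<forall>s\<in>S. \<phi> s = s" and m: "move S (\<phi> x) y"
  obtains \<kappa> where "\<kappa> \<in> H" "automorphism (\<kappa> \<circ> \<phi>)" "(\<kappa> \<circ> \<phi>) a = a" "\<forall>s\<in>S. (\<kappa> \<circ> \<phi>) s = s"
    "(\<kappa> \<circ> \<phi>) x = y"
proof -
  obtain \<kappa> where "\<kappa> \<in> H" "\<forall>s\<in>S. \<kappa> s = s" "\<kappa> (\<phi> x) = y" using m unfolding move_def by blast
  with \<phi> S show ?thesis by (intro that[of \<kappa>]) (auto simp: H_def automorphism_comp)
qed

text \<open>
  The images of \<open>v 0\<close>, \<open>v 1\<close>, \<open>v 2\<close> are put in place one after the other; injectivity of the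
  automorphism provides the non-zero pivots.\<close>

lemma stabilizer_G:
  assumes \<phi>: "automorphism \<phi>" "\<phi> a = a"
  shows "diag \<phi> \<in> G"
proof -
  have v0_nz: "v 0 \<noteq> 0" using dual[of 0 0] by auto
  have "\<exists>i<3. polar (\<phi> (v 0)) (w i) \<noteq> 0"
  proof (rule ccontr)
    assume "\<not> ?thesis"
    then have "\<phi> (v 0) = 0" using automorphism_V[OF \<phi>, of 0] by (simp add: vec_def)
    then have "\<phi> (v 0) = \<phi> 0" using automorphism_properties(3)[OF \<phi>(1), of 0 0] by simp
    then show False using automorphism_inj[OF \<phi>(1)] v0_nz by blast
  qed
  then have "move {} (\<phi> (v 0)) (v 0)"
    using automorphism_V[OF \<phi>, of 0] move_v0[of "\<lambda>j. polar (\<phi> (v 0)) (w j)"] by (auto simp: lt3)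
  then obtain \<kappa>0 where \<kappa>0: "\<kappa>0 \<in> H" "automorphism (\<kappa>0 \<circ> \<phi>)" "(\<kappa>0 \<circ> \<phi>) a = a" "(\<kappa>0 \<circ> \<phi>) (v 0) = v 0"
    using automorphism_H_step[OF \<phi>, of "{}" "v 0"] by (metis empty_iff)
  define \<phi>1 where "\<phi>1 = \<kappa>0 \<circ> \<phi>"
  have \<phi>1: "automorphism \<phi>1" "\<phi>1 a = a" "\<phi>1 (v 0) = v 0" using \<kappa>0 by (simp_all only: \<phi>1_def)
  have "polar (\<phi>1 (v 1)) (w 1) \<noteq> 0 \<or> polar (\<phi>1 (v 1)) (w 2) \<noteq> 0"
  proof (rule ccontr)
    define k where "k = polar (\<phi>1 (v 1)) (w 0)"
    assume "\<not> ?thesis"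
    then have "\<phi>1 (v 1) = k *s v 0" using automorphism_V[OF \<phi>1(1,2), of 1] by (simp add: vec_def k_def)
    also have "\<dots> = \<phi>1 (k *s v 0)" using automorphism_properties(3)[OF \<phi>1(1)] \<phi>1(3) by simp
    finally have "v 1 = k *s v 0" using automorphism_inj[OF \<phi>1(1)] by blast
    then show False using dual[of 1 1] dual[of 0 1] by (simp add: polar_simps)
  qed
  then have "move {v 0} (\<phi>1 (v 1)) (v 1)"
    using automorphism_V[OF \<phi>1(1,2), of 1] move_v1[of "\<lambda>j. polar (\<phi>1 (v 1)) (w j)"] by auto
  then obtain \<kappa>1 where \<kappa>1: "\<kappa>1 \<in> H" "automorphism (\<kappa>1 \<circ> \<phi>1)" "(\<kappa>1 \<circ> \<phi>1) a = a"
      "(\<kappa>1 \<circ> \<phi>1) (v 0) = v 0" "(\<kappa>1 \<circ> \<phi>1) (v 1) = v 1"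
    using automorphism_H_step[OF \<phi>1(1,2), of "{v 0}" "v 1"] \<phi>1(3) by (metis singletonD singletonI)
  define \<phi>2 where "\<phi>2 = \<kappa>1 \<circ> \<phi>1"
  have \<phi>2: "automorphism \<phi>2" "\<phi>2 a = a" "\<phi>2 (v 0) = v 0" "\<phi>2 (v 1) = v 1"
    using \<kappa>1 by (simp_all only: \<phi>2_def)
  define d where "d = polar (\<phi>2 (v 2)) (w 2)"
  have d: "d \<noteq> 0"
  proof
    define k l where "k = polar (\<phi>2 (v 2)) (w 0)" and "l = polar (\<phi>2 (v 2)) (w 1)"
    assume "d = 0"
    then have "\<phi>2 (v 2) = k *s v 0 + l *s v 1"
      using automorphism_V[OF \<phi>2(1,2), of 2] by (simp add: vec_def k_def l_def d_def)
    also have "\<dots> = \<phi>2 (k *s v 0 + l *s v 1)"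
      using automorphism_properties(2,3)[OF \<phi>2(1)] \<phi>2(3,4) by simp
    finally have "v 2 = k *s v 0 + l *s v 1" using automorphism_inj[OF \<phi>2(1)] by blast
    then show False using dual[of 2 2] dual[of 0 2] dual[of 1 2] by (simp add: polar_simps)
  qed
  then have "move {v 0, v 1} (\<phi>2 (v 2)) (d *s v 2)"
    using automorphism_V[OF \<phi>2(1,2), of 2] move_v2[of "\<lambda>j. polar (\<phi>2 (v 2)) (w j)"] by (simp add: d_def)
  then obtain \<kappa>2 where \<kappa>2: "\<kappa>2 \<in> H" "automorphism (\<kappa>2 \<circ> \<phi>2)" "(\<kappa>2 \<circ> \<phi>2) a = a"
      "\<forall>s\<in>{v 0, v 1}. (\<kappa>2 \<circ> \<phi>2) s = s" "(\<kappa>2 \<circ> \<phi>2) (v 2) = d *s v 2"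
    using automorphism_H_step[OF \<phi>2(1,2), of "{v 0, v 1}" "v 2"] \<phi>2(3,4) by (metis insert_iff singletonD)
  have "\<kappa>2 \<circ> \<phi>2 = id" by (rule fixes_basis[OF \<kappa>2(2,3) _ _ \<kappa>2(5) d]) (use \<kappa>2(4) in auto)
  moreover have "diag id \<in> G" using id_H by (simp add: H_def)
  ultimately have "diag \<phi>2 \<in> G" using G_diag_cancel[of \<kappa>2 \<phi>2] \<kappa>2(1) \<phi>2(1) by (simp add: H_def)
  then have "diag \<phi>1 \<in> G" using G_diag_cancel[of \<kappa>1 \<phi>1] \<kappa>1(1) \<phi>1(1) by (simp add: H_def \<phi>2_def)
  then show ?thesis using G_diag_cancel[of \<kappa>0 \<phi>] \<kappa>0(1) \<phi>(1) by (simp add: H_def \<phi>1_def)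
qed

end

context split_octonion_algebra
begin

lemma idempotent_exists: obtains a where "T a = 1" "N a = 0"
proof -
  obtain x where x: "x \<noteq> 0" "N x = 0" using split by blast
  obtain y where "T (y \<odot> x) = 1" using T_mul_value[OF x(1)] .
  then show ?thesis using that[of "y \<odot> x"] x by (simp add: N_mul)
qed

text \<open>
  If \<open>a\<close> and its image are orthogonal, \<open>move_idempotent\<close> does not apply directly, but both are
  non-orthogonal to \<open>bar a\<close>, which serves as an intermediate station.\<close>

lemma automorphism_G:
  assumes \<phi>: "automorphism \<phi>"
  shows "diag \<phi> \<in> G"
proof -
  obtain a where a: "T a = 1" "N a = 0" by (rule idempotent_exists)
  obtain v w k0 k1 where "peirce_basis scale mul e N a v w k0 k1" using peirce_basis_exists[OF a] by blast
  then interpret P: peirce_basis scale mul e N a v w k0 k1 .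
  have b: "T (\<phi> a) = 1" "N (\<phi> a) = 0" using automorphism_properties[OF \<phi>] a by simp_all
  have "\<exists>\<kappa>. automorphism \<kappa> \<and> diag \<kappa> \<in> G \<and> \<kappa> (\<phi> a) = a"
  proof (cases "polar a (\<phi> a) = 0")
    case False
    then show ?thesis using move_idempotent[OF a b] by metis
  next
    case True
    have c: "T (bar a) = 1" "N (bar a) = 0" using a by simp_all
    have "polar (bar a) (\<phi> a) \<noteq> 0"
      using True b by (simp add: idempotent(1)[OF a] polar_diff) (simp add: T_def polar_commute)
    then obtain \<kappa>1 where \<kappa>1: "automorphism \<kappa>1" "diag \<kappa>1 \<in> G" "\<kappa>1 (\<phi> a) = bar a"
      using move_idempotent[OF c b] by metis
    have "polar a (bar a) \<noteq> 0" using idempotent(7)[OF a] by simp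
    then obtain \<kappa>2 where \<kappa>2: "automorphism \<kappa>2" "diag \<kappa>2 \<in> G" "\<kappa>2 (bar a) = a"
      using move_idempotent[OF a c] by metis
    then show ?thesis using \<kappa>1 G_comp[of "diag \<kappa>2" "diag \<kappa>1"]
      by (intro exI[of _ "\<kappa>2 \<circ> \<kappa>1"]) (simp add: automorphism_comp diag_comp)
  qed
  then obtain \<kappa> where \<kappa>: "automorphism \<kappa>" "diag \<kappa> \<in> G" "\<kappa> (\<phi> a) = a" by blast
  have "diag (\<kappa> \<circ> \<phi>) \<in> G" by (rule P.stabilizer_G) (use \<kappa> \<phi> in \<open>auto simp: automorphism_comp\<close>)
  then show ?thesis using G_diag_cancel \<kappa>(2) \<phi> by blast
qed

text \<open>
  The reductions combined.  The choice \<open>y = x \<odot> bar u\<close> gives \<open>y \<odot> u = x\<close>, so that the pair of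
  reflections moves \<open>u = \<alpha>' e\<close> to \<open>e\<close> on the first entry; orthogonality of \<open>x\<close> to \<open>e\<close> and \<open>u\<close> makes
  both \<open>x\<close> and \<open>y\<close> orthogonal to \<open>e\<close>, so that \<open>e\<close> stays fixed on the third.\<close>

lemma SE6_G:
  assumes g: "g \<in> carrier SE6"
  shows "g \<in> G"
proof -
  obtain a where a: "T a = 1" "N a = 0" by (rule idempotent_exists)
  obtain h1 where h1: "h1 \<in> G" "(h1 \<circ> g) E1 = E1" "(h1 \<circ> g) E2 = E2" "(h1 \<circ> g) E3 = E3"
    by (rule move_to_frame[OF g])
  have g1: "h1 \<circ> g \<in> carrier SE6" using h1(1) g by (simp add: SE6_comp G_SE6)
  obtain \<alpha> \<beta> \<gamma> where gv: "\<And>a b c A B C. (h1 \<circ> g) (a, b, c, A, B, C) = (a, b, c, \<alpha> A, \<beta> B, \<gamma> C)"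
    using frame_fixed[OF g1 h1(2-4)] by blast
  note t = triality_isometries[OF g1 gv]
  have 0: "\<alpha> 0 = 0" "\<beta> 0 = 0" using gv[of 0 0 0 0 0 0] SE6_0[OF g1] by (auto simp: zero_prod_def)
  have "N (\<gamma> e) = 1" by (simp add: t N_e)
  then obtain h2 where h2: "h2 \<in> G" "h2 E1 = E1" "h2 E2 = E2" "h2 E3 = E3"
      "h2 (0, 0, 0, 0, 0, \<gamma> e) = (0, 0, 0, 0, 0, e)"
    using right_multiplication by blast
  define g2 where "g2 = h2 \<circ> (h1 \<circ> g)"
  have g2: "g2 \<in> carrier SE6" "g2 E1 = E1" "g2 E2 = E2" "g2 E3 = E3" "g2 (0, 0, 0, 0, 0, e) = (0, 0, 0, 0, 0, e)"
    using h1(2-4) h2 SE6_comp[OF G_SE6[OF h2(1)] g1]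
    by (simp_all add: g2_def comp_apply[of h2] 0 gv del: comp_apply)
  obtain \<alpha>' \<beta>' \<gamma>' where gv': "\<And>a b c A B C. g2 (a, b, c, A, B, C) = (a, b, c, \<alpha>' A, \<beta>' B, \<gamma>' C)"
    using frame_fixed[OF g2(1-4)] by blast
  note t' = triality_isometries[OF g2(1) gv']
  have e': "\<gamma>' e = e" "\<alpha>' 0 = 0" "\<beta>' 0 = 0" "\<gamma>' 0 = 0" using g2(5) gv' g2(2) by auto
  define u where "u = \<alpha>' e"
  have u: "N u = 1" by (simp add: u_def t' N_e)
  obtain x where x: "polar x e = 0" "polar x u = 0" "N x \<noteq> 0"
    using nonsingular_orthogonal[OF a] by metis
  define y where "y = x \<odot> bar u"
  have y: "N y = N x" "y \<odot> u = x" "polar y e = 0"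
    using u x by (simp_all add: y_def N_mul polar_mul_right unit_left)
  obtain h3 where h3: "h3 \<in> G" "\<And>a b c A B C. h3 (a, b, c, A, B, C) =
    (a, b, c, (1 / N x) *s (bar x \<odot> (y \<odot> A)), (1 / N x) *s ((B \<odot> y) \<odot> bar x),
     reflection x (reflection y C))"
    using reflection_pair[of x y] x y by auto
  have h3g: "h3 \<circ> g2 \<in> carrier SE6" using h3 g2 by (simp add: SE6_comp G_SE6)
  have r: "reflection x e = e" "reflection y e = e" "reflection z 0 = 0" for z
    using x y by (simp_all add: reflection_def polar_commute[of e])
  obtain \<phi> where \<phi>: "automorphism \<phi>" "h3 \<circ> g2 = diag \<phi>"
    by (rule automorphism_frame[OF h3g])
      (use x in \<open>simp_all add: gv' h3(2) r e' u_def[symmetric] y\<close>)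
  then have "h3 \<circ> g2 \<in> G" using automorphism_G by simp
  then have "g2 \<in> G" using G_cancel h3(1) g2(1) by blast
  then have "h1 \<circ> g \<in> G" unfolding g2_def using G_cancel h2(1) g1 by blast
  then show ?thesis using G_cancel h1(1) g by blast
qed

end

section \<open>Generation\<close>

theorem theorem9p7:
  fixes scale :: "'f::field \<Rightarrow> 'o::ab_group_add \<Rightarrow> 'o"
    and mul :: "'o \<Rightarrow> 'o \<Rightarrow> 'o"
    and e :: 'o
    and N :: "'o \<Rightarrow> 'f"
  assumes "split_octonion_algebra scale mul e N"
  shows "generate (octonion_algebra.SE6 scale mul e N)
           (range (octonion_algebra.M scale mul e N) \<union>
            range (octonion_algebra.M' scale mul e N) \<union>
            range (octonion_algebra.M'' scale mul e N) \<union>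
            range (octonion_algebra.L scale mul e N) \<union>
            range (octonion_algebra.L' scale mul e N) \<union>
            range (octonion_algebra.L'' scale mul e N))
         = carrier (octonion_algebra.SE6 scale mul e N)"
proof -
  interpret split_octonion_algebra scale mul e N by (rule assms)
  have "G = carrier SE6" using G_SE6 SE6_G by blast
  then show ?thesis unfolding G_def .
qed

end
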